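(* Under the theory $\mathsf{ZF}$ (Zermelo–Fraenkel set theory without the Axiom of Choice), the following four statements are equivalent: (1) every linearly orderable family of nonempty finite sets has a choice function; (2) the union of any pairwise disjoint linearly orderable family of finite sets is linearly orderable; (3) for every nonempty preorder $\mathbb P\in\mathcal L$ and every family $\mathcal D$ of dense subsets of $\mathbb P$ (with no restriction on $\mathcal D$), there exists a $\mathcal D$-generic filter $G\subseteq\mathbb P$ such that the set $G$ is linearly orderable; (4) there exists an $n$ with $1\leq n<\omega$ such that, for every nonempty preorder $\mathbb P\in\mathcal L_n$ and every family $\mathcal D$ of dense subsets of $\mathbb P$, there exists a $\mathcal D$-generic filter $G\subseteq\mathbb P$ such that the set $G$ is linearly orderable.
   Context: A set is linearly orderable if there exists some linear (total) order on it; a family of sets is linearly orderable if it is so when regarded as a set (whose elements are the members of the family). A preorder is a set $\mathbb P$ with a reflexive and transitive relation $\leq$. Two elements $p,q\in\mathbb P$ are compatible if there exists $r\in\mathbb P$ with $r\leq p$ and $r\leq q$; otherwise they are incompatible. A subset $A\subseteq\mathbb P$ is an antichain if any two distinct elements of $A$ are incompatible. A subset $D\subseteq\mathbb P$ is dense if for every $p\in\mathbb P$ there is $q\in D$ with $q\leq p$. A subset $G\subseteq\mathbb P$ is a filter if it is closed upwards ($p\in G$ and $p\leq q$ imply $q\in G$) and for all $p,q\in G$ there exists $r\in G$ with $r\leq p$ and $r\leq q$. A filter $G$ is $\mathcal D$-generic if $G\cap D\neq\varnothing$ for every $D\in\mathcal D$. For $n<\omega$, $\mathcal L_n$ denotes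 the class of all preorders whose underlying set is the union of a pairwise disjoint linearly orderable family of finite sets, and such that every antichain has size at most $n$. Also $\mathcal L=\bigcup_{n<\omega}\mathcal L_n$. The linear order on $G$ in (3) and (4) need not have any relation to the preorder $\leq$. *)

theory Defs
  imports Main
begin

text \<open>
  HOL itself validates the axiom of choice, so ``under ZF'' is rendered as ``in every model of
  first-order ZF'' (equivalently, by completeness, ``ZF proves''). A model is a type \<open>'v\<close> with a
  binary relation; nothing is assumed about it beyond the first-order axioms, so it may be
  nonstandard. Every notion below is \<^emph>\<open>internal\<close>: quantifiers range over \<open>'v\<close> only, functions
  and relations are elements of the model (sets of Kuratowski pairs), and natural numbers are
  the elements of the \<open>\<omega>\<close> of the model.

  Separation and Replacement must range over first-order formulas (with parameters) only.
  Stated for arbitrary HOL predicates they would, with choice in HOL, force choice in the model.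
\<close>

datatype fm =
    FMem nat nat
  | FEq nat nat
  | FNot fm
  | FAnd fm fm
  | FAll nat fm

locale set_structure =
  fixes mem :: "'v \<Rightarrow> 'v \<Rightarrow> bool"  (infix "\<^bold>\<in>" 50)
begin

primrec sat :: "fm \<Rightarrow> (nat \<Rightarrow> 'v) \<Rightarrow> bool" where
  "sat (FMem i j) s \<longleftrightarrow> s i \<^bold>\<in> s j"
| "sat (FEq i j) s \<longleftrightarrow> s i = s j"
| "sat (FNot \<phi>) s \<longleftrightarrow> \<not> sat \<phi> s"
| "sat (FAnd \<phi> \<psi>) s \<longleftrightarrow> sat \<phi> s \<and> sat \<psi> s"
| "sat (FAll i \<phi>) s \<longleftrightarrow> (\<forall>x. sat \<phi> (s(i := x)))"

definition is_subset :: "'v \<Rightarrow> 'v \<Rightarrow> bool" where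
  "is_subset a b \<longleftrightarrow> (\<forall>x. x \<^bold>\<in> a \<longrightarrow> x \<^bold>\<in> b)"

definition is_empty :: "'v \<Rightarrow> bool" where
  "is_empty a \<longleftrightarrow> (\<forall>x. \<not> x \<^bold>\<in> a)"

definition is_upair :: "'v \<Rightarrow> 'v \<Rightarrow> 'v \<Rightarrow> bool" where
  "is_upair z a b \<longleftrightarrow> (\<forall>x. x \<^bold>\<in> z \<longleftrightarrow> x = a \<or> x = b)"

definition is_union :: "'v \<Rightarrow> 'v \<Rightarrow> bool" where
  "is_union u F \<longleftrightarrow> (\<forall>x. x \<^bold>\<in> u \<longleftrightarrow> (\<exists>X. X \<^bold>\<in> F \<and> x \<^bold>\<in> X))"

definition is_succ :: "'v \<Rightarrow> 'v \<Rightarrow> bool" where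
  "is_succ s a \<longleftrightarrow> (\<forall>x. x \<^bold>\<in> s \<longleftrightarrow> x \<^bold>\<in> a \<or> x = a)"

definition is_inductive :: "'v \<Rightarrow> bool" where
  "is_inductive w \<longleftrightarrow>
     (\<exists>z. is_empty z \<and> z \<^bold>\<in> w) \<and> (\<forall>x. x \<^bold>\<in> w \<longrightarrow> (\<exists>s. is_succ s x \<and> s \<^bold>\<in> w))"

text \<open>\<open>n < \<omega>\<close>, as \<open>\<omega>\<close> is the intersection of all inductive sets:\<close>

definition is_nat :: "'v \<Rightarrow> bool" where
  "is_nat n \<longleftrightarrow> (\<forall>w. is_inductive w \<longrightarrow> n \<^bold>\<in> w)"

text \<open>\<open>1 \<le> n\<close> for von Neumann naturals, i.e. \<open>{\<emptyset>} \<subseteq> n\<close>:\<close>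

definition ge_one :: "'v \<Rightarrow> bool" where
  "ge_one n \<longleftrightarrow> (\<exists>z one. is_empty z \<and> is_succ one z \<and> is_subset one n)"

text \<open>\<open>p = {{a}, {a, b}}\<close>:\<close>

definition is_opair :: "'v \<Rightarrow> 'v \<Rightarrow> 'v \<Rightarrow> bool" where
  "is_opair p a b \<longleftrightarrow> (\<forall>z. z \<^bold>\<in> p \<longleftrightarrow> is_upair z a a \<or> is_upair z a b)"

definition related :: "'v \<Rightarrow> 'v \<Rightarrow> 'v \<Rightarrow> bool" where
  "related r x y \<longleftrightarrow> (\<exists>p. is_opair p x y \<and> p \<^bold>\<in> r)"

text \<open>\<open>r \<subseteq> a \<times> b\<close>:\<close>

definition is_relation :: "'v \<Rightarrow> 'v \<Rightarrow> 'v \<Rightarrow> bool" where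
  "is_relation r a b \<longleftrightarrow>
     (\<forall>p. p \<^bold>\<in> r \<longrightarrow> (\<exists>x y. x \<^bold>\<in> a \<and> y \<^bold>\<in> b \<and> is_opair p x y))"

definition is_function :: "'v \<Rightarrow> 'v \<Rightarrow> 'v \<Rightarrow> bool" where
  "is_function f a b \<longleftrightarrow> is_relation f a b \<and> (\<forall>x. x \<^bold>\<in> a \<longrightarrow> (\<exists>!y. related f x y))"

definition is_injection :: "'v \<Rightarrow> 'v \<Rightarrow> 'v \<Rightarrow> bool" where
  "is_injection f a b \<longleftrightarrow>
     is_function f a b \<and> (\<forall>x x' y. related f x y \<and> related f x' y \<longrightarrow> x = x')"

definition is_bijection :: "'v \<Rightarrow> 'v \<Rightarrow> 'v \<Rightarrow> bool" where
  "is_bijection f a b \<longleftrightarrow>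
     is_injection f a b \<and> (\<forall>y. y \<^bold>\<in> b \<longrightarrow> (\<exists>x. related f x y))"

definition is_finite :: "'v \<Rightarrow> bool" where
  "is_finite a \<longleftrightarrow> (\<exists>n f. is_nat n \<and> is_bijection f a n)"

definition size_at_most :: "'v \<Rightarrow> 'v \<Rightarrow> bool" where
  "size_at_most a n \<longleftrightarrow> (\<exists>f. is_injection f a n)"

definition is_linear_order :: "'v \<Rightarrow> 'v \<Rightarrow> bool" where
  "is_linear_order r a \<longleftrightarrow> is_relation r a a \<and>
     (\<forall>x. x \<^bold>\<in> a \<longrightarrow> related r x x) \<and>
     (\<forall>x y z. related r x y \<and> related r y z \<longrightarrow> related r x z) \<and>
     (\<forall>x y. related r x y \<and> related r y x \<longrightarrow> x = y) \<and>
     (\<forall>x y. x \<^bold>\<in> a \<and> y \<^bold>\<in> a \<longrightarrow> related r x y \<or> related r y x)"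

definition lin_orderable :: "'v \<Rightarrow> bool" where
  "lin_orderable a \<longleftrightarrow> (\<exists>r. is_linear_order r a)"

definition pairwise_disjoint :: "'v \<Rightarrow> bool" where
  "pairwise_disjoint F \<longleftrightarrow>
     (\<forall>X Y. X \<^bold>\<in> F \<and> Y \<^bold>\<in> F \<and> X \<noteq> Y \<longrightarrow> \<not> (\<exists>x. x \<^bold>\<in> X \<and> x \<^bold>\<in> Y))"

definition family_of_finite :: "'v \<Rightarrow> bool" where
  "family_of_finite F \<longleftrightarrow> (\<forall>X. X \<^bold>\<in> F \<longrightarrow> is_finite X)"

definition is_choice_function :: "'v \<Rightarrow> 'v \<Rightarrow> bool" where
  "is_choice_function f F \<longleftrightarrow>
     (\<exists>b. is_function f F b) \<and> (\<forall>X x. X \<^bold>\<in> F \<and> related f X x \<longrightarrow> x \<^bold>\<in> X)"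

text \<open>In the following \<open>P\<close> is the underlying set and \<open>related R p q\<close> is \<open>p \<le> q\<close>.\<close>

definition is_preorder :: "'v \<Rightarrow> 'v \<Rightarrow> bool" where
  "is_preorder P R \<longleftrightarrow> is_relation R P P \<and>
     (\<forall>p. p \<^bold>\<in> P \<longrightarrow> related R p p) \<and>
     (\<forall>p q r. related R p q \<and> related R q r \<longrightarrow> related R p r)"

definition compatible :: "'v \<Rightarrow> 'v \<Rightarrow> 'v \<Rightarrow> 'v \<Rightarrow> bool" where
  "compatible P R p q \<longleftrightarrow> (\<exists>r. r \<^bold>\<in> P \<and> related R r p \<and> related R r q)"

definition is_antichain :: "'v \<Rightarrow> 'v \<Rightarrow> 'v \<Rightarrow> bool" where
  "is_antichain P R A \<longleftrightarrow> is_subset A P \<and>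
     (\<forall>p q. p \<^bold>\<in> A \<and> q \<^bold>\<in> A \<and> p \<noteq> q \<longrightarrow> \<not> compatible P R p q)"

definition is_dense :: "'v \<Rightarrow> 'v \<Rightarrow> 'v \<Rightarrow> bool" where
  "is_dense P R D \<longleftrightarrow> is_subset D P \<and>
     (\<forall>p. p \<^bold>\<in> P \<longrightarrow> (\<exists>q. q \<^bold>\<in> D \<and> related R q p))"

text \<open>As in the source, a filter is not required to be nonempty.\<close>

definition is_filter :: "'v \<Rightarrow> 'v \<Rightarrow> 'v \<Rightarrow> bool" where
  "is_filter P R G \<longleftrightarrow> is_subset G P \<and>
     (\<forall>p q. p \<^bold>\<in> G \<and> q \<^bold>\<in> P \<and> related R p q \<longrightarrow> q \<^bold>\<in> G) \<and>
     (\<forall>p q. p \<^bold>\<in> G \<and> q \<^bold>\<in> G \<longrightarrow> (\<exists>r. r \<^bold>\<in> G \<and> related R r p \<and> related R r q))"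

definition is_generic_filter :: "'v \<Rightarrow> 'v \<Rightarrow> 'v \<Rightarrow> 'v \<Rightarrow> bool" where
  "is_generic_filter P R \<D> G \<longleftrightarrow> is_filter P R G \<and>
     (\<forall>D. D \<^bold>\<in> \<D> \<longrightarrow> (\<exists>p. p \<^bold>\<in> G \<and> p \<^bold>\<in> D))"

definition in_L_n :: "'v \<Rightarrow> 'v \<Rightarrow> 'v \<Rightarrow> bool" where
  "in_L_n n P R \<longleftrightarrow> is_preorder P R \<and>
     (\<exists>F. pairwise_disjoint F \<and> lin_orderable F \<and> family_of_finite F \<and> is_union P F) \<and>
     (\<forall>A. is_antichain P R A \<longrightarrow> size_at_most A n)"

definition in_L :: "'v \<Rightarrow> 'v \<Rightarrow> bool" where
  "in_L P R \<longleftrightarrow> (\<exists>n. is_nat n \<and> in_L_n n P R)"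

definition has_lin_orderable_generics :: "'v \<Rightarrow> 'v \<Rightarrow> bool" where
  "has_lin_orderable_generics P R \<longleftrightarrow>
     (\<forall>\<D>. (\<forall>D. D \<^bold>\<in> \<D> \<longrightarrow> is_dense P R D) \<longrightarrow>
       (\<exists>G. is_generic_filter P R \<D> G \<and> lin_orderable G))"

definition choice_for_lin_orderable_families :: bool where
  "choice_for_lin_orderable_families \<longleftrightarrow>
     (\<forall>F. lin_orderable F \<and> family_of_finite F \<and> (\<forall>X. X \<^bold>\<in> F \<longrightarrow> \<not> is_empty X)
        \<longrightarrow> (\<exists>f. is_choice_function f F))"

definition unions_lin_orderable :: bool where
  "unions_lin_orderable \<longleftrightarrow>
     (\<forall>F U. pairwise_disjoint F \<and> lin_orderable F \<and> family_of_finite F \<and> is_union U F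
        \<longrightarrow> lin_orderable U)"

definition generics_for_L :: bool where
  "generics_for_L \<longleftrightarrow>
     (\<forall>P R. \<not> is_empty P \<and> in_L P R \<longrightarrow> has_lin_orderable_generics P R)"

definition generics_for_some_L_n :: bool where
  "generics_for_some_L_n \<longleftrightarrow>
     (\<exists>n. is_nat n \<and> ge_one n \<and>
       (\<forall>P R. \<not> is_empty P \<and> in_L_n n P R \<longrightarrow> has_lin_orderable_generics P R))"

end

locale ZF_model = set_structure mem
  for mem :: "'v \<Rightarrow> 'v \<Rightarrow> bool"  (infix "\<^bold>\<in>" 50) +
  assumes extensionality: "\<And>a b. (\<forall>x. x \<^bold>\<in> a \<longleftrightarrow> x \<^bold>\<in> b) \<Longrightarrow> a = b"
    and foundation: "\<And>a. \<not> is_empty a \<Longrightarrow> \<exists>x. x \<^bold>\<in> a \<and> \<not> (\<exists>y. y \<^bold>\<in> x \<and> y \<^bold>\<in> a)"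
    and pairing: "\<And>a b. \<exists>z. is_upair z a b"
    and union: "\<And>F. \<exists>u. is_union u F"
    and powerset: "\<And>a. \<exists>p. \<forall>x. x \<^bold>\<in> p \<longleftrightarrow> is_subset x a"
    and infinity: "\<exists>w. is_inductive w"
    and separation: "\<And>\<phi> s a. \<exists>b. \<forall>x. x \<^bold>\<in> b \<longleftrightarrow> x \<^bold>\<in> a \<and> sat \<phi> (s(0 := x))"
    and replacement: "\<And>\<phi> s a.
      (\<forall>x y z. x \<^bold>\<in> a \<and> sat \<phi> (s(0 := x, 1 := y)) \<and> sat \<phi> (s(0 := x, 1 := z)) \<longrightarrow> y = z) \<Longrightarrow>
      \<exists>b. \<forall>y. y \<^bold>\<in> b \<longleftrightarrow> (\<exists>x. x \<^bold>\<in> a \<and> sat \<phi> (s(0 := x, 1 := y)))"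

end

theory Submission
  imports Defs
begin

text \<open>
  (1) implies (2) by choosing a linear order on each set of the family, and (2) implies (1) by
  taking minima. For (3), bounded antichains force an element \<open>p\<close> below which any two elements are
  compatible; the elements compatible with \<open>p\<close> then form a filter meeting every dense set, and by
  (2) the whole preorder is linearly orderable. Conversely (4) yields (2) by applying it to the
  union with the preorder in which all elements are equivalent.

  Separation, replacement and induction on the internal natural numbers are available for definable
  predicates only, so definability is tracked throughout: \<open>D Q\<close> says that \<open>Q\<close> is given by a
  first-order formula with parameters, \<open>T t\<close> that \<open>t\<close> has such a graph.
\<close>

section \<open>Definable predicates and terms\<close>

text \<open>The metalogic has choice while the model need not. A function obtained in HOL may
  therefore serve to reason about the model, but not to build its sets. Definability is kept
  semantic, as closure properties of HOL predicates on environments, so that a certificate follows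
  the shape of a statement instead of a formula being written out. The bound \<open>n\<close> on
  antichains may be nonstandard, so the descent to an element without incompatible extensions has to
  be an internal induction as well. In passing from (1) to (2), a finite set has in general several
  linear orders with none singled out. What makes (1) applicable is that the set of all of them is
  again finite and determines the set it orders.\<close>

primrec rename :: "(nat \<Rightarrow> nat) \<Rightarrow> fm \<Rightarrow> fm" where
  "rename f (FMem i j) = FMem (f i) (f j)"
| "rename f (FEq i j) = FEq (f i) (f j)"
| "rename f (FNot \<phi>) = FNot (rename f \<phi>)"
| "rename f (FAnd \<phi> \<psi>) = FAnd (rename f \<phi>) (rename f \<psi>)"
| "rename f (FAll i \<phi>) = FAll (f i) (rename f \<phi>)"

text \<open>One assignment must hold both the variables of an environment and the parameters of a
  formula. Even slots carry the former and odd slots the latter, so neither supply runs out.\<close>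

definition interleave :: "(nat \<Rightarrow> 'a) \<Rightarrow> (nat \<Rightarrow> 'a) \<Rightarrow> nat \<Rightarrow> 'a" where
  "interleave e p i = (if even i then e (i div 2) else p (i div 2))"

lemma interleave_simps [simp]:
  "interleave e p (2 * i) = e i" "interleave e p (Suc (2 * i)) = p i"
  by (simp_all add: interleave_def)

lemma nat_even_odd_cases:
  fixes n :: nat
  obtains k where "n = 2 * k" | k where "n = Suc (2 * k)"
  by (metis evenE oddE Suc_eq_plus1)

lemma ext_even_odd:
  assumes "\<And>i. f (2 * i) = g (2 * i)" "\<And>i. f (Suc (2 * i)) = g (Suc (2 * i))"
  shows "f = (g :: nat \<Rightarrow> 'a)"
  using assms by (metis ext nat_even_odd_cases)

lemma inj_interleave:
  assumes "inj f" "inj g" "\<And>i j. f i \<noteq> g j"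
  shows "inj (interleave f g)"
proof (rule injI)
  fix m n assume "interleave f g m = interleave f g n"
  then show "m = n"
    using assms not_sym[OF assms(3)]
    by (cases m rule: nat_even_odd_cases; cases n rule: nat_even_odd_cases) (simp_all add: inj_eq)
qed

context set_structure
begin

text \<open>Bound variables are named, so renaming could capture; injectivity of \<open>f\<close>
  keeps the update at \<open>f i\<close> from touching any other variable.\<close>

lemma sat_rename:
  assumes "inj f"
  shows "sat (rename f \<phi>) s \<longleftrightarrow> sat \<phi> (\<lambda>i. s (f i))"
proof (induction \<phi> arbitrary: s)
  case (FAll i \<phi>)
  have "(\<lambda>j. (s(f i := x)) (f j)) = (\<lambda>j. s (f j))(i := x)" for x
    using assms by (auto simp: fun_eq_iff inj_eq)
  with FAll show ?case by (simp add: fun_upd_def)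
qed simp_all

text \<open>Environments \<open>e\<close> are read as de Bruijn contexts: the most recently bound variable is
  \<open>e 0\<close>. The sequence \<open>p\<close> supplies parameters, which therefore appear as constants in \<open>Q\<close>.\<close>

definition D :: "((nat \<Rightarrow> 'v) \<Rightarrow> bool) \<Rightarrow> bool" where
  "D Q \<longleftrightarrow> (\<exists>\<phi> p. \<forall>e. Q e \<longleftrightarrow> sat \<phi> (interleave e p))"

definition T :: "((nat \<Rightarrow> 'v) \<Rightarrow> 'v) \<Rightarrow> bool" where
  "T t \<longleftrightarrow> D (\<lambda>e. e 0 = t (\<lambda>i. e (Suc i)))"

section \<open>Closure of definability under renaming, connectives and quantifiers\<close>

text \<open>Injective maps cover weakening and permutation of variables. Identifying variables is
  left to substitution, which goes through an existential quantifier.\<close>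

lemma D_rename:
  assumes "D Q" "inj f"
  shows "D (\<lambda>e. Q (\<lambda>i. e (f i)))"
proof -
  from \<open>D Q\<close> obtain \<phi> p where Q: "\<And>e. Q e \<longleftrightarrow> sat \<phi> (interleave e p)"
    by (auto simp: D_def)
  define g where "g = interleave (\<lambda>i. 2 * f i) (\<lambda>i. Suc (2 * i))"
  have "inj g"
    unfolding g_def using \<open>inj f\<close> by (intro inj_interleave) (auto simp: inj_def, presburger)
  moreover have "interleave (\<lambda>i. e (f i)) p = (\<lambda>i. interleave e p (g i))" for e
    by (rule ext_even_odd) (simp_all add: g_def)
  ultimately have "Q (\<lambda>i. e (f i)) \<longleftrightarrow> sat (rename g \<phi>) (interleave e p)" for e
    by (simp add: Q sat_rename)
  then show ?thesis by (auto simp: D_def)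
qed

lemma D_const: "D (\<lambda>e. b)"
proof -
  have "b \<longleftrightarrow> sat (if b then FEq 0 0 else FNot (FEq 0 0)) (interleave e p)" for e p
    by simp
  then show ?thesis unfolding D_def by blast
qed

lemma D_mem_var: "D (\<lambda>e. e i \<^bold>\<in> e j)"
proof -
  have "e i \<^bold>\<in> e j \<longleftrightarrow> sat (FMem (2 * i) (2 * j)) (interleave e p)" for e p
    by simp
  then show ?thesis unfolding D_def by blast
qed

lemma D_eq_var: "D (\<lambda>e. e i = e j)"
proof -
  have "e i = e j \<longleftrightarrow> sat (FEq (2 * i) (2 * j)) (interleave e p)" for e p
    by simp
  then show ?thesis unfolding D_def by blast
qed

lemma D_eq_const: "D (\<lambda>e. e i = c)"
proof -
  have "e i = c \<longleftrightarrow> sat (FEq (2 * i) (Suc (2 * 0))) (interleave e (\<lambda>_. c))" for e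
    by (simp only: sat.simps interleave_simps)
  then show ?thesis unfolding D_def by blast
qed

lemma D_not: "D Q \<Longrightarrow> D (\<lambda>e. \<not> Q e)"
  unfolding D_def by (metis sat.simps(3))

text \<open>The two formulas come with unrelated parameter sequences. These are interleaved, and
  each formula is renamed to use its own half of the odd slots.\<close>

lemma D_and:
  assumes "D Q" "D R"
  shows "D (\<lambda>e. Q e \<and> R e)"
proof -
  from assms obtain \<phi> p \<psi> q where Q: "\<And>e. Q e \<longleftrightarrow> sat \<phi> (interleave e p)"
    and R: "\<And>e. R e \<longleftrightarrow> sat \<psi> (interleave e q)"
    by (auto simp: D_def)
  define g h where "g = interleave (\<lambda>i. 2 * i) (\<lambda>i. Suc (2 * (2 * i)))"
    and "h = interleave (\<lambda>i. 2 * i) (\<lambda>i. Suc (2 * Suc (2 * i)))"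
  have "inj g"
    unfolding g_def by (rule inj_interleave) (auto simp: inj_def, presburger?)
  have "inj h"
    unfolding h_def by (rule inj_interleave) (auto simp: inj_def, presburger?)
  have eq: "interleave e p = (\<lambda>i. interleave e (interleave p q) (g i))"
    "interleave e q = (\<lambda>i. interleave e (interleave p q) (h i))" for e
    by (rule ext_even_odd; simp only: g_def h_def interleave_simps)+
  from \<open>inj g\<close> \<open>inj h\<close> have
    "Q e \<and> R e \<longleftrightarrow> sat (FAnd (rename g \<phi>) (rename h \<psi>)) (interleave e (interleave p q))" for e
    unfolding Q R eq(1)[of e] eq(2)[of e] by (simp only: sat.simps sat_rename)
  then show ?thesis unfolding D_def by blast
qed

text \<open>The outer environment takes all even slots, so the bound variable is housed in slot 1
  and every parameter moves up one place. The value \<open>undefined\<close> in that slot is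
  overwritten by the quantifier.\<close>

lemma D_all:
  assumes "D (\<lambda>e. P (\<lambda>i. e (Suc i)) (e 0))"
  shows "D (\<lambda>e. \<forall>x. P e x)"
proof -
  from assms obtain \<phi> p
    where P: "\<And>e. P (\<lambda>i. e (Suc i)) (e 0) \<longleftrightarrow> sat \<phi> (interleave e p)"
    by (auto simp: D_def)
  define g where "g = interleave (case_nat 1 (\<lambda>i. 2 * i)) (\<lambda>i. Suc (2 * Suc i))"
  have "inj g"
    unfolding g_def by (rule inj_interleave) (auto simp: inj_def split: nat.splits, presburger+)
  have eq: "interleave (case_nat x e) p =
      (\<lambda>i. ((interleave e (case_nat undefined p))(1 := x)) (g i))" for e x
  proof (rule ext_even_odd)
    fix i
    have "case_nat x e i =
        ((interleave e (case_nat undefined p))(1 := x)) (case_nat 1 (\<lambda>i. 2 * i) i)"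
      by (cases i) auto
    then show "interleave (case_nat x e) p (2 * i) =
        ((interleave e (case_nat undefined p))(1 := x)) (g (2 * i))"
      by (simp only: g_def interleave_simps)
    have "p i = ((interleave e (case_nat undefined p))(1 := x)) (Suc (2 * Suc i))"
      by (simp only: fun_upd_def interleave_simps) simp
    then show "interleave (case_nat x e) p (Suc (2 * i)) =
        ((interleave e (case_nat undefined p))(1 := x)) (g (Suc (2 * i)))"
      by (simp only: g_def interleave_simps)
  qed
  have "P e x \<longleftrightarrow> sat \<phi> (interleave (case_nat x e) p)" for e x
    using P[of "case_nat x e"] by simp
  then have "(\<forall>x. P e x) \<longleftrightarrow>
      sat (FAll 1 (rename g \<phi>)) (interleave e (case_nat undefined p))" for e
    using \<open>inj g\<close> by (simp add: eq sat_rename)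
  then show ?thesis unfolding D_def by blast
qed

lemma D_or: "D Q \<Longrightarrow> D R \<Longrightarrow> D (\<lambda>e. Q e \<or> R e)"
  using D_not[OF D_and[OF D_not D_not]] by simp

lemma D_imp: "D Q \<Longrightarrow> D R \<Longrightarrow> D (\<lambda>e. Q e \<longrightarrow> R e)"
  unfolding imp_conv_disj by (intro D_or D_not)

lemma D_iff: "D Q \<Longrightarrow> D R \<Longrightarrow> D (\<lambda>e. Q e \<longleftrightarrow> R e)"
  unfolding iff_conv_conj_imp by (intro D_and D_imp)

lemma D_ex:
  assumes "D (\<lambda>e. P (\<lambda>i. e (Suc i)) (e 0))"
  shows "D (\<lambda>e. \<exists>x. P e x)"
proof -
  have "D (\<lambda>e. \<not> (\<forall>x. \<not> P e x))"
    using assms by (intro D_not D_all)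
  then show ?thesis by simp
qed

section \<open>Definable terms and substitution\<close>

lemma T_var: "T (\<lambda>e. e i)"
  unfolding T_def by (rule D_eq_var)

lemma T_const: "T (\<lambda>e. c)"
  unfolding T_def by (rule D_eq_const)

lemma T_lift:
  assumes "T t"
  shows "T (\<lambda>e. t (\<lambda>i. e (Suc i)))"
  using D_rename[of "\<lambda>e. e 0 = t (\<lambda>i. e (Suc i))" "case_nat 0 (\<lambda>i. Suc (Suc i))"] assms
  by (auto simp: T_def inj_def split: nat.splits)

lemma T_lift2: "T t \<Longrightarrow> T (\<lambda>e. t (\<lambda>i. e (Suc (Suc i))))"
  using T_lift[OF T_lift] .

text \<open>Writing \<open>P (t e)\<close> as \<open>\<exists>x. x = t e \<and> P x\<close> uses
  only the graph of \<open>t\<close>. With the two- and three-place versions below, a notion has to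
  be certified for plain variables only.\<close>

lemma D_subst1:
  assumes "D (\<lambda>e. P (e 0))" "T t"
  shows "D (\<lambda>e. P (t e))"
proof -
  have "D (\<lambda>e. \<exists>x. x = t e \<and> P x)"
    using assms unfolding T_def by (intro D_ex D_and)
  then show ?thesis by simp
qed

lemma D_swap: "D (\<lambda>e. P (e 0) (e 1)) \<Longrightarrow> D (\<lambda>e. P (e 1) (e 0))"
  using D_rename[of "\<lambda>e. P (e 0) (e 1)" "id(0 := 1, 1 := 0)"]
  by (auto simp: inj_def)

lemma D_subst2:
  assumes "D (\<lambda>e. P (e 0) (e 1))" "T t" "T u"
  shows "D (\<lambda>e. P (t e) (u e))"
proof -
  \<comment> \<open>Inside both quantifiers \<open>y\<close> is variable 0 and \<open>x\<close> is
    variable 1, hence the swapped form of the assumption.\<close>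
  have "D (\<lambda>e. \<exists>x. x = t e \<and> (\<exists>y. y = u e \<and> P x y))"
    using D_swap[OF assms(1)] \<open>T t\<close> T_lift[OF \<open>T u\<close>] unfolding T_def
    by (intro D_ex D_and) simp_all
  then show ?thesis by simp
qed

lemma D_subst3:
  assumes "D (\<lambda>e. P (e 0) (e 1) (e 2))" "T t" "T u" "T v"
  shows "D (\<lambda>e. P (t e) (u e) (v e))"
proof -
  have "D (\<lambda>e. P (e 2) (e 1) (e 0))"
    using D_rename[OF assms(1), of "id(0 := 2, 2 := 0)"] by (auto simp: inj_def)
  then have "D (\<lambda>e. \<exists>x. x = t e \<and> (\<exists>y. y = u e \<and> (\<exists>z. z = v e \<and> P x y z)))"
    using \<open>T t\<close> T_lift[OF \<open>T u\<close>] T_lift2[OF \<open>T v\<close>] unfolding T_def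
    by (intro D_ex D_and) (simp_all add: numeral_2_eq_2)
  then show ?thesis by simp
qed

lemma D_mem: "T t \<Longrightarrow> T u \<Longrightarrow> D (\<lambda>e. t e \<^bold>\<in> u e)"
  by (rule D_subst2) (rule D_mem_var)

lemma D_eq: "T t \<Longrightarrow> T u \<Longrightarrow> D (\<lambda>e. t e = u e)"
  by (rule D_subst2) (rule D_eq_var)

lemma T_subst1:
  assumes "T (\<lambda>e. f (e 0))" "T t"
  shows "T (\<lambda>e. f (t e))"
proof -
  have "D (\<lambda>e. e 0 = f (e 1))"
    using assms(1) by (simp add: T_def)
  then show ?thesis
    unfolding T_def by (rule D_subst2[where P = "\<lambda>x y. x = f y"]) (rule T_var, rule T_lift[OF assms(2)])
qed

lemma T_subst2:
  assumes "T (\<lambda>e. f (e 0) (e 1))" "T t" "T u"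
  shows "T (\<lambda>e. f (t e) (u e))"
proof -
  have "D (\<lambda>e. e 0 = f (e 1) (e 2))"
    using assms(1) by (simp add: T_def numeral_2_eq_2)
  then show ?thesis
    unfolding T_def
    by (rule D_subst3[where P = "\<lambda>x y z. x = f y z"])
      (rule T_var, rule T_lift[OF assms(2)], rule T_lift[OF assms(3)])
qed

lemmas D_logic = D_const D_not D_and D_or D_imp D_iff D_all D_ex D_mem D_eq T_var T_const

text \<open>Unfolding \<open>\<exists>!\<close> puts a second copy of \<open>P\<close> under one
  more binder, which that copy must skip; this is the doubly shifted form of the hypothesis.\<close>

lemma D_ex1: "D (\<lambda>e. P (\<lambda>i. e (Suc i)) (e 0)) \<Longrightarrow> D (\<lambda>e. \<exists>!x. P e x)"
proof -
  assume P: "D (\<lambda>e. P (\<lambda>i. e (Suc i)) (e 0))"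
  have "D (\<lambda>e. P (\<lambda>i. e (Suc (Suc i))) (e 0))"
    using D_rename[OF P, of "case_nat 0 (\<lambda>i. Suc (Suc i))"]
    by (auto simp: inj_def split: nat.splits)
  with P show ?thesis
    unfolding Ex1_def by (intro D_logic)
qed

section \<open>Definability of the set-theoretic vocabulary\<close>

lemma D_is_subset: "T a \<Longrightarrow> T b \<Longrightarrow> D (\<lambda>e. is_subset (a e) (b e))"
  by (rule D_subst2[where P = is_subset]) (unfold is_subset_def, intro D_logic)

lemma D_is_empty: "T a \<Longrightarrow> D (\<lambda>e. is_empty (a e))"
  by (rule D_subst1[where P = is_empty]) (unfold is_empty_def, intro D_logic)

lemma D_is_succ: "T a \<Longrightarrow> T b \<Longrightarrow> D (\<lambda>e. is_succ (a e) (b e))"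
  by (rule D_subst2[where P = is_succ]) (unfold is_succ_def, intro D_logic)

lemma D_is_inductive: "T a \<Longrightarrow> D (\<lambda>e. is_inductive (a e))"
  by (rule D_subst1[where P = is_inductive])
    (unfold is_inductive_def, intro D_logic D_is_empty D_is_succ)

lemma D_is_nat: "T a \<Longrightarrow> D (\<lambda>e. is_nat (a e))"
  by (rule D_subst1[where P = is_nat]) (unfold is_nat_def, intro D_logic D_is_inductive)

lemma D_is_upair: "T a \<Longrightarrow> T b \<Longrightarrow> T c \<Longrightarrow> D (\<lambda>e. is_upair (a e) (b e) (c e))"
  by (rule D_subst3[where P = is_upair]) (unfold is_upair_def, intro D_logic)

lemma D_is_opair: "T a \<Longrightarrow> T b \<Longrightarrow> T c \<Longrightarrow> D (\<lambda>e. is_opair (a e) (b e) (c e))"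
  by (rule D_subst3[where P = is_opair]) (unfold is_opair_def, intro D_logic D_is_upair)

lemma D_related: "T a \<Longrightarrow> T b \<Longrightarrow> T c \<Longrightarrow> D (\<lambda>e. related (a e) (b e) (c e))"
  by (rule D_subst3[where P = related]) (unfold related_def, intro D_logic D_is_opair)

lemma D_is_relation: "T a \<Longrightarrow> T b \<Longrightarrow> T c \<Longrightarrow> D (\<lambda>e. is_relation (a e) (b e) (c e))"
  by (rule D_subst3[where P = is_relation]) (unfold is_relation_def, intro D_logic D_is_opair)

lemma D_is_function: "T a \<Longrightarrow> T b \<Longrightarrow> T c \<Longrightarrow> D (\<lambda>e. is_function (a e) (b e) (c e))"
  by (rule D_subst3[where P = is_function])
    (unfold is_function_def, intro D_logic D_ex1 D_is_relation D_related)

lemma D_is_injection: "T a \<Longrightarrow> T b \<Longrightarrow> T c \<Longrightarrow> D (\<lambda>e. is_injection (a e) (b e) (c e))"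
  by (rule D_subst3[where P = is_injection])
    (unfold is_injection_def, intro D_logic D_is_function D_related)

lemma D_is_bijection: "T a \<Longrightarrow> T b \<Longrightarrow> T c \<Longrightarrow> D (\<lambda>e. is_bijection (a e) (b e) (c e))"
  by (rule D_subst3[where P = is_bijection])
    (unfold is_bijection_def, intro D_logic D_is_injection D_related)

lemma D_is_finite: "T a \<Longrightarrow> D (\<lambda>e. is_finite (a e))"
  by (rule D_subst1[where P = is_finite])
    (unfold is_finite_def, intro D_logic D_is_nat D_is_bijection)

lemma D_size_at_most: "T a \<Longrightarrow> T b \<Longrightarrow> D (\<lambda>e. size_at_most (a e) (b e))"
  by (rule D_subst2[where P = size_at_most]) (unfold size_at_most_def, intro D_logic D_is_injection)

lemma D_is_linear_order: "T a \<Longrightarrow> T b \<Longrightarrow> D (\<lambda>e. is_linear_order (a e) (b e))"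
  by (rule D_subst2[where P = is_linear_order])
    (unfold is_linear_order_def, intro D_logic D_is_relation D_related)

lemma D_lin_orderable: "T a \<Longrightarrow> D (\<lambda>e. lin_orderable (a e))"
  by (rule D_subst1[where P = lin_orderable])
    (unfold lin_orderable_def, intro D_logic D_is_linear_order)

lemma D_compatible:
  "T a \<Longrightarrow> T b \<Longrightarrow> D (\<lambda>e. compatible P R (a e) (b e))"
  by (rule D_subst2[where P = "compatible P R"])
    (unfold compatible_def, intro D_logic D_related)

lemma D_is_antichain: "T a \<Longrightarrow> D (\<lambda>e. is_antichain P R (a e))"
  by (rule D_subst1[where P = "is_antichain P R"])
    (unfold is_antichain_def, intro D_logic D_is_subset D_compatible)

lemmas D_intros = D_logic D_is_subset D_is_empty D_is_succ D_is_nat D_is_opair D_related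
  D_is_finite D_size_at_most D_is_linear_order D_lin_orderable D_compatible D_is_antichain

end

section \<open>Set-building operations in a model of ZF\<close>

context set_structure
begin

text \<open>\<open>Coll P\<close> is the set \<open>{x. P x}\<close> of the model; it is junk unless \<open>setlike P\<close>.\<close>

definition setlike :: "('v \<Rightarrow> bool) \<Rightarrow> bool" where
  "setlike P \<longleftrightarrow> (\<exists>b. \<forall>x. x \<^bold>\<in> b \<longleftrightarrow> P x)"

definition Coll :: "('v \<Rightarrow> bool) \<Rightarrow> 'v" where
  "Coll P = (THE b. \<forall>x. x \<^bold>\<in> b \<longleftrightarrow> P x)"

definition opair :: "'v \<Rightarrow> 'v \<Rightarrow> 'v" where
  "opair a b = (THE p. is_opair p a b)"

definition empty :: 'v where
  "empty = Coll (\<lambda>_. False)"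

definition ins :: "'v \<Rightarrow> 'v \<Rightarrow> 'v" where
  "ins a X = Coll (\<lambda>x. x = a \<or> x \<^bold>\<in> X)"

definition remove :: "'v \<Rightarrow> 'v \<Rightarrow> 'v" where
  "remove a X = Coll (\<lambda>x. x \<^bold>\<in> X \<and> x \<noteq> a)"

definition un :: "'v \<Rightarrow> 'v \<Rightarrow> 'v" where
  "un X Y = Coll (\<lambda>x. x \<^bold>\<in> X \<or> x \<^bold>\<in> Y)"

definition power :: "'v \<Rightarrow> 'v" where
  "power X = Coll (\<lambda>Y. is_subset Y X)"

definition img :: "('v \<Rightarrow> 'v) \<Rightarrow> 'v \<Rightarrow> 'v" where
  "img h X = Coll (\<lambda>y. \<exists>x. x \<^bold>\<in> X \<and> y = h x)"

definition graph :: "'v \<Rightarrow> 'v \<Rightarrow> ('v \<Rightarrow> 'v \<Rightarrow> bool) \<Rightarrow> 'v" where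
  "graph a b P = Coll (\<lambda>p. \<exists>x y. x \<^bold>\<in> a \<and> y \<^bold>\<in> b \<and> P x y \<and> p = opair x y)"

definition linear_orders :: "'v \<Rightarrow> 'v" where
  "linear_orders X = Coll (\<lambda>r. is_linear_order r X)"

lemma is_upair_unique_left:
  "is_upair z a b \<Longrightarrow> is_upair z c d \<Longrightarrow> a = c \<and> b = d \<or> a = d \<and> b = c"
  unfolding is_upair_def by metis

end

context ZF_model
begin

text \<open>Slot 0 of the interleaved assignment is variable 0 of the environment, which is also the
  variable that the separation scheme ranges over.\<close>

lemma separation_D:
  assumes "D (\<lambda>e. P (e 0))"
  shows "setlike (\<lambda>x. x \<^bold>\<in> a \<and> P x)"
proof -
  from assms obtain \<phi> p where P: "\<And>e. P (e 0) \<longleftrightarrow> sat \<phi> (interleave e p)"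
    by (auto simp: D_def)
  have "(interleave e p)(0 := x) = interleave (e(0 := x)) p" for e x
    by (auto simp: interleave_def fun_eq_iff)
  then have "sat \<phi> ((interleave (\<lambda>_. a) p)(0 := x)) \<longleftrightarrow> P x" for x
    using P[of "(\<lambda>_. a)(0 := x)"] by simp
  then show ?thesis
    using separation[of a \<phi> "interleave (\<lambda>_. a) p"] by (simp add: setlike_def)
qed

lemma replacement_T:
  assumes "T (\<lambda>e. h (e 0))"
  shows "setlike (\<lambda>y. \<exists>x. x \<^bold>\<in> a \<and> y = h x)"
proof -
  have "D (\<lambda>e. e 1 = h (e 0))"
    using assms D_swap[of "\<lambda>x y. x = h y"] by (simp add: T_def)
  then obtain \<phi> p where P: "\<And>e. e 1 = h (e 0) \<longleftrightarrow> sat \<phi> (interleave e p)"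
    by (auto simp: D_def)
  \<comment> \<open>Replacement reads its output from slot 1, but in an interleaved assignment
    variable 1 sits in slot 2 and slot 1 holds a parameter, so the two slots are exchanged.\<close>
  define g where "g = (id :: nat \<Rightarrow> nat)(1 := 2, 2 := 1)"
  define s where "s = (\<lambda>i. interleave (\<lambda>_. a) p (g i))"
  have "inj g" by (auto simp: g_def inj_def)
  have "(\<lambda>i. (s(0 := x, 1 := y)) (g i)) = interleave ((\<lambda>_. a)(0 := x, 1 := y)) p" for x y
    by (auto simp: s_def g_def interleave_def fun_eq_iff elim!: evenE oddE)
  then have "sat (rename g \<phi>) (s(0 := x, 1 := y)) \<longleftrightarrow> y = h x" for x y
    using P[of "(\<lambda>_. a)(0 := x, 1 := y)"] \<open>inj g\<close> by (simp add: sat_rename)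
  then show ?thesis
    using replacement[of a "rename g \<phi>" s] by (simp add: setlike_def)
qed

lemma Coll_unique:
  assumes "\<And>x. x \<^bold>\<in> b \<longleftrightarrow> P x"
  shows "Coll P = b"
  unfolding Coll_def using assms by (intro the_equality) (auto intro: extensionality)

lemma mem_Coll: "setlike P \<Longrightarrow> x \<^bold>\<in> Coll P \<longleftrightarrow> P x"
  using Coll_unique by (auto simp: setlike_def)

text \<open>By extensionality the graph is \<open>\<forall>x\<close> of a membership equivalence.
  This describes \<open>Coll (P e)\<close> only if the set exists, so \<open>setlike\<close> is
  demanded at every environment.\<close>

lemma T_Coll:
  assumes "D (\<lambda>e. P (\<lambda>i. e (Suc i)) (e 0))" "\<And>e. setlike (P e)"
  shows "T (\<lambda>e. Coll (P e))"
proof -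
  have "b = Coll (P e) \<longleftrightarrow> (\<forall>x. x \<^bold>\<in> b \<longleftrightarrow> P e x)" for b e
    using mem_Coll[OF assms(2)] Coll_unique by metis
  moreover have "D (\<lambda>e. P (\<lambda>i. e (Suc (Suc i))) (e 0))"
    using D_rename[OF assms(1), of "case_nat 0 (\<lambda>i. Suc (Suc i))"]
    by (auto simp: inj_def split: nat.splits)
  ultimately show ?thesis
    unfolding T_def by (simp, intro D_logic)
qed

section \<open>Ordered pairs and basic set operations\<close>

lemma is_upair_exists1: "\<exists>!z. is_upair z a b"
  using pairing[of a b] extensionality unfolding is_upair_def by (metis (full_types))

lemma is_opair_exists1: "\<exists>!p. is_opair p a b"
proof -
  obtain u v where u: "is_upair u a a" and v: "is_upair v a b"
    using pairing by blast
  obtain p where p: "is_upair p u v"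
    using pairing by blast
  then have "is_opair p a b"
    using u v is_upair_exists1 unfolding is_opair_def is_upair_def[of p] by metis
  then show ?thesis
    using extensionality unfolding is_opair_def by (metis (full_types))
qed

lemma is_opair_iff: "is_opair p a b \<longleftrightarrow> p = opair a b"
  unfolding opair_def by (metis is_opair_exists1 theI')

lemma opair_inject [simp]: "opair a b = opair c d \<longleftrightarrow> a = c \<and> b = d"
proof
  assume eq: "opair a b = opair c d"
  have *: "z \<^bold>\<in> opair x y \<longleftrightarrow> is_upair z x x \<or> is_upair z x y" for x y z
    using is_opair_iff[of "opair x y" x y] by (simp add: is_opair_def)
  have "is_upair z a a \<or> is_upair z a b \<longleftrightarrow> is_upair z c c \<or> is_upair z c d" for z
    using *[of z a b] *[of z c d] eq by simp
  then show "a = c \<and> b = d"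
    using is_upair_exists1 is_upair_unique_left by metis
qed simp

lemma related_iff: "related r x y \<longleftrightarrow> opair x y \<^bold>\<in> r"
  by (simp add: related_def is_opair_iff)

lemma T_opair: "T a \<Longrightarrow> T b \<Longrightarrow> T (\<lambda>e. opair (a e) (b e))"
  by (rule T_subst2[where f = opair])
    (unfold T_def is_opair_iff[symmetric], intro D_logic D_is_opair)

lemma setlike_union: "setlike (\<lambda>x. \<exists>X. X \<^bold>\<in> F \<and> x \<^bold>\<in> X)"
  using union[of F] by (simp add: setlike_def is_union_def)

lemma setlike_un: "setlike (\<lambda>x. x \<^bold>\<in> X \<or> x \<^bold>\<in> Y)"
proof -
  obtain z where z: "is_upair z X Y" using pairing by blast
  then show ?thesis using setlike_union[of z] by (auto simp: is_upair_def setlike_def)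
qed

lemma mem_empty [simp]: "\<not> x \<^bold>\<in> empty"
proof -
  have "setlike (\<lambda>x. x \<^bold>\<in> x \<and> False)"
    using separation_D[of "\<lambda>_. False" x] by (simp add: setlike_def D_const)
  then show ?thesis unfolding empty_def by (simp add: mem_Coll)
qed

lemma setlike_ins: "setlike (\<lambda>x. x = a \<or> x \<^bold>\<in> X)"
proof -
  obtain z where z: "is_upair z a a" using pairing by blast
  then show ?thesis using setlike_un[of z X] by (simp add: is_upair_def)
qed

lemma setlike_remove: "setlike (\<lambda>x. x \<^bold>\<in> X \<and> x \<noteq> a)"
  by (intro separation_D D_logic)

lemma setlike_power: "setlike (\<lambda>Y. is_subset Y X)"
  using powerset by (simp add: setlike_def)

lemma mem_ins [simp]: "x \<^bold>\<in> ins a X \<longleftrightarrow> x = a \<or> x \<^bold>\<in> X"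
  unfolding ins_def by (rule mem_Coll[OF setlike_ins])

lemma mem_remove [simp]: "x \<^bold>\<in> remove a X \<longleftrightarrow> x \<^bold>\<in> X \<and> x \<noteq> a"
  unfolding remove_def by (rule mem_Coll[OF setlike_remove])

lemma mem_un [simp]: "x \<^bold>\<in> un X Y \<longleftrightarrow> x \<^bold>\<in> X \<or> x \<^bold>\<in> Y"
  unfolding un_def by (rule mem_Coll[OF setlike_un])

lemma mem_power [simp]: "Y \<^bold>\<in> power X \<longleftrightarrow> is_subset Y X"
  unfolding power_def by (rule mem_Coll[OF setlike_power])

lemma mem_img: "T (\<lambda>e. h (e 0)) \<Longrightarrow> y \<^bold>\<in> img h X \<longleftrightarrow> (\<exists>x. x \<^bold>\<in> X \<and> y = h x)"
  unfolding img_def by (intro mem_Coll replacement_T)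

lemma T_ins: "T a \<Longrightarrow> T b \<Longrightarrow> T (\<lambda>e. ins (a e) (b e))"
  by (rule T_subst2[where f = ins])
    (unfold ins_def, intro T_Coll D_logic setlike_ins)

lemma T_un: "T a \<Longrightarrow> T b \<Longrightarrow> T (\<lambda>e. un (a e) (b e))"
  by (rule T_subst2[where f = un])
    (unfold un_def, intro T_Coll D_logic setlike_un)

lemma T_power: "T a \<Longrightarrow> T (\<lambda>e. power (a e))"
  by (rule T_subst1[where f = power])
    (unfold power_def, intro T_Coll D_intros setlike_power)

lemma T_img:
  assumes h: "T (\<lambda>e. h (e 0))" and "T a"
  shows "T (\<lambda>e. img h (a e))"
  by (rule T_subst1[where f = "img h", OF _ \<open>T a\<close>])
    (unfold img_def, intro T_Coll D_logic replacement_T T_subst1[of h, OF h] h)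

lemma ext_iff: "a = b \<longleftrightarrow> (\<forall>x. x \<^bold>\<in> a \<longleftrightarrow> x \<^bold>\<in> b)"
  using extensionality by blast

lemma is_empty_iff: "is_empty a \<longleftrightarrow> a = empty"
  by (simp add: is_empty_def ext_iff)

lemma is_succ_iff: "is_succ s a \<longleftrightarrow> s = ins a a"
  by (auto simp: is_succ_def ext_iff)

lemma opair_mem_power: "x \<^bold>\<in> a \<Longrightarrow> y \<^bold>\<in> a \<Longrightarrow> opair x y \<^bold>\<in> power (power a)"
  using is_opair_iff[of "opair x y" x y]
  by (auto simp: is_opair_def is_upair_def is_subset_def)

text \<open>All pairs in question lie in \<open>power (power (un a b))\<close>, so separation
  applies without first building a product.\<close>

lemma setlike_graph:
  assumes "D (\<lambda>e. P (e 0) (e 1))"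
  shows "setlike (\<lambda>p. \<exists>x y. x \<^bold>\<in> a \<and> y \<^bold>\<in> b \<and> P x y \<and> p = opair x y)"
proof -
  have "setlike (\<lambda>p. p \<^bold>\<in> power (power (un a b)) \<and>
      (\<exists>x y. x \<^bold>\<in> a \<and> y \<^bold>\<in> b \<and> P x y \<and> p = opair x y))"
    by (intro separation_D D_intros T_opair D_subst2[of P, OF assms])
  moreover have "p \<^bold>\<in> power (power (un a b)) \<and>
        (\<exists>x y. x \<^bold>\<in> a \<and> y \<^bold>\<in> b \<and> P x y \<and> p = opair x y) \<longleftrightarrow>
      (\<exists>x y. x \<^bold>\<in> a \<and> y \<^bold>\<in> b \<and> P x y \<and> p = opair x y)" for p
    using opair_mem_power[of _ "un a b"] by (auto simp del: mem_power)
  ultimately show ?thesis by simp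
qed

lemma related_graph:
  "D (\<lambda>e. P (e 0) (e 1)) \<Longrightarrow> related (graph a b P) x y \<longleftrightarrow> x \<^bold>\<in> a \<and> y \<^bold>\<in> b \<and> P x y"
  unfolding related_iff graph_def using mem_Coll[OF setlike_graph] by auto

lemma is_relation_graph: "D (\<lambda>e. P (e 0) (e 1)) \<Longrightarrow> is_relation (graph a b P) a b"
  unfolding is_relation_def is_opair_iff graph_def using mem_Coll[OF setlike_graph] by auto

lemma is_relationD:
  "is_relation r a b \<Longrightarrow> related r x y \<Longrightarrow> x \<^bold>\<in> a \<and> y \<^bold>\<in> b"
  by (auto simp: is_relation_def related_iff is_opair_iff)

text \<open>The order is obtained as the \<open>graph\<close> of a definable predicate, whose
  behaviour outside \<open>a\<close> is left open.\<close>

lemma lin_orderableI: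
  assumes "D (\<lambda>e. P (e 0) (e 1))"
    and "\<And>x. x \<^bold>\<in> a \<Longrightarrow> P x x"
    and "\<And>x y z. x \<^bold>\<in> a \<Longrightarrow> y \<^bold>\<in> a \<Longrightarrow> z \<^bold>\<in> a \<Longrightarrow> P x y \<Longrightarrow> P y z \<Longrightarrow> P x z"
    and "\<And>x y. x \<^bold>\<in> a \<Longrightarrow> y \<^bold>\<in> a \<Longrightarrow> P x y \<Longrightarrow> P y x \<Longrightarrow> x = y"
    and "\<And>x y. x \<^bold>\<in> a \<Longrightarrow> y \<^bold>\<in> a \<Longrightarrow> P x y \<or> P y x"
  shows "lin_orderable a"
proof -
  have "is_linear_order (graph a a P) a"
    unfolding is_linear_order_def related_graph[OF assms(1)]
    using assms(2-) is_relation_graph[OF assms(1)] by blast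
  then show ?thesis by (auto simp: lin_orderable_def)
qed

lemma is_linear_orderD:
  assumes "is_linear_order r a"
  shows is_linear_order_refl: "\<And>x. x \<^bold>\<in> a \<Longrightarrow> related r x x"
    and is_linear_order_trans: "\<And>x y z. related r x y \<Longrightarrow> related r y z \<Longrightarrow> related r x z"
    and is_linear_order_antisym: "\<And>x y. related r x y \<Longrightarrow> related r y x \<Longrightarrow> x = y"
    and is_linear_order_total: "\<And>x y. x \<^bold>\<in> a \<Longrightarrow> y \<^bold>\<in> a \<Longrightarrow> related r x y \<or> related r y x"
    and is_linear_order_mem: "\<And>x y. related r x y \<Longrightarrow> x \<^bold>\<in> a \<and> y \<^bold>\<in> a"
  using assms is_relationD[of r a a] unfolding is_linear_order_def by blast+

lemma lin_orderable_subset: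
  assumes "lin_orderable a" "is_subset b a"
  shows "lin_orderable b"
proof -
  from assms obtain r where r: "is_linear_order r a" by (auto simp: lin_orderable_def)
  have D: "D (\<lambda>e. related r (e 0) (e 1))" by (intro D_intros)
  have "x \<^bold>\<in> a" if "x \<^bold>\<in> b" for x
    using assms(2) that by (simp add: is_subset_def)
  then show ?thesis
    by (intro lin_orderableI[OF D]) (metis is_linear_orderD[OF r])+
qed

text \<open>The order is carried along \<open>h\<close>. It is phrased through preimages bound by
  \<open>\<exists>\<close> rather than an inverse function, so that definability is visible.\<close>

lemma lin_orderable_img:
  assumes "lin_orderable a" "T (\<lambda>e. h (e 0))"
    and inj: "\<And>x y. x \<^bold>\<in> a \<Longrightarrow> y \<^bold>\<in> a \<Longrightarrow> h x = h y \<Longrightarrow> x = y"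
  shows "lin_orderable (img h a)"
proof -
  from assms obtain r where r: "is_linear_order r a" by (auto simp: lin_orderable_def)
  define P where
    "P u v \<longleftrightarrow> (\<exists>x y. x \<^bold>\<in> a \<and> y \<^bold>\<in> a \<and> u = h x \<and> v = h y \<and> related r x y)" for u v
  have *: "P (h x) (h y) \<longleftrightarrow> related r x y" if "x \<^bold>\<in> a" "y \<^bold>\<in> a" for x y
    unfolding P_def using that inj by metis
  have D: "D (\<lambda>e. P (e 0) (e 1))"
    unfolding P_def by (intro D_intros T_subst1[of h, OF assms(2)])
  have "\<exists>x. x \<^bold>\<in> a \<and> u = h x" if "u \<^bold>\<in> img h a" for u
    using that by (simp add: mem_img[OF assms(2)])
  then show ?thesis
    by (intro lin_orderableI[OF D]) (metis * is_linear_orderD[OF r])+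
qed

end

section \<open>Internal natural numbers and finite sets\<close>

context ZF_model
begin

lemma mem_irrefl: "\<not> x \<^bold>\<in> x"
  using foundation[of "ins x empty"] by (auto simp: is_empty_def)

lemma is_inductive_iff:
  "is_inductive w \<longleftrightarrow> empty \<^bold>\<in> w \<and> (\<forall>x. x \<^bold>\<in> w \<longrightarrow> ins x x \<^bold>\<in> w)"
  by (simp add: is_inductive_def is_empty_iff is_succ_iff)

lemma is_nat_empty: "is_nat empty"
  by (simp add: is_nat_def is_inductive_iff)

lemma is_nat_succ: "is_nat n \<Longrightarrow> is_nat (ins n n)"
  by (simp add: is_nat_def is_inductive_iff)

text \<open>The elements of an inductive set that are natural and satisfy \<open>Q\<close> again
  form an inductive set, which therefore contains \<open>n\<close>. Definability of \<open>Q\<close>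
  is what makes them a set of the model.\<close>

lemma is_nat_induct [consumes 1, case_names definable empty succ]:
  assumes "is_nat n" "D (\<lambda>e. Q (e 0))" "Q empty" "\<And>n. is_nat n \<Longrightarrow> Q n \<Longrightarrow> Q (ins n n)"
  shows "Q n"
proof -
  obtain w where w: "is_inductive w" using infinity by blast
  have "setlike (\<lambda>x. x \<^bold>\<in> w \<and> (is_nat x \<and> Q x))"
    using assms(2) by (intro separation_D D_intros)
  then obtain b where b: "\<And>x. x \<^bold>\<in> b \<longleftrightarrow> x \<^bold>\<in> w \<and> is_nat x \<and> Q x"
    by (auto simp: setlike_def)
  have "is_inductive b"
    using w assms(3,4) is_nat_empty is_nat_succ by (auto simp: is_inductive_iff b)
  with \<open>is_nat n\<close> show ?thesis
    using b by (auto simp: is_nat_def)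
qed

section \<open>Internal injections and finite sets\<close>

lemma is_injection_graph:
  assumes "D (\<lambda>e. P (e 0) (e 1))"
    and "\<And>x. x \<^bold>\<in> a \<Longrightarrow> \<exists>!y. y \<^bold>\<in> b \<and> P x y"
    and "\<And>x x' y. x \<^bold>\<in> a \<Longrightarrow> x' \<^bold>\<in> a \<Longrightarrow> y \<^bold>\<in> b \<Longrightarrow> P x y \<Longrightarrow> P x' y \<Longrightarrow> x = x'"
  shows "is_injection (graph a b P) a b"
  unfolding is_injection_def is_function_def related_graph[OF assms(1)]
  using assms(2,3) is_relation_graph[OF assms(1)] by auto

lemma is_injectionE:
  assumes "is_injection f a b"
  obtains "\<And>x y. related f x y \<Longrightarrow> x \<^bold>\<in> a \<and> y \<^bold>\<in> b"
    and "\<And>x. x \<^bold>\<in> a \<Longrightarrow> \<exists>y. related f x y"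
    and "\<And>x y z. related f x y \<Longrightarrow> related f x z \<Longrightarrow> y = z"
    and "\<And>x y z. related f x z \<Longrightarrow> related f y z \<Longrightarrow> x = y"
proof
  show rel: "x \<^bold>\<in> a \<and> y \<^bold>\<in> b" if "related f x y" for x y
    using assms that is_relationD unfolding is_injection_def is_function_def by blast
  show "y = z" if "related f x y" "related f x z" for x y z
    using assms that rel unfolding is_injection_def is_function_def by blast
qed (use assms in \<open>unfold is_injection_def is_function_def, blast+\<close>)

lemma size_at_most_empty: "size_at_most a empty \<Longrightarrow> a = empty"
  by (auto simp: size_at_most_def ext_iff elim!: is_injectionE)

text \<open>If the injection \<open>f\<close> sends some element of \<open>A\<close> to \<open>n\<close>, send it to \<open>f r\<close> instead.\<close>

lemma size_at_most_ins_succ: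
  assumes "size_at_most (ins r A) (ins n n)" "\<not> r \<^bold>\<in> A"
  shows "size_at_most A n"
proof -
  obtain f where "is_injection f (ins r A) (ins n n)"
    using assms(1) by (auto simp: size_at_most_def)
  then show ?thesis
  proof (rule is_injectionE)
    assume rel: "\<And>x y. related f x y \<Longrightarrow> x \<^bold>\<in> ins r A \<and> y \<^bold>\<in> ins n n"
      and total: "\<And>x. x \<^bold>\<in> ins r A \<Longrightarrow> \<exists>y. related f x y"
      and func: "\<And>x y z. related f x y \<Longrightarrow> related f x z \<Longrightarrow> y = z"
      and inj: "\<And>x y z. related f x z \<Longrightarrow> related f y z \<Longrightarrow> x = y"
    define P where
      "P x y \<longleftrightarrow> related f x n \<and> related f r y \<or> \<not> related f x n \<and> related f x y" for x y
    have "is_injection (graph A n P) A n"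
    proof (rule is_injection_graph)
      show "D (\<lambda>e. P (e 0) (e 1))"
        unfolding P_def by (intro D_intros)
      show "\<exists>!y. y \<^bold>\<in> n \<and> P x y" if x: "x \<^bold>\<in> A" for x
      proof (cases "related f x n")
        case True
        moreover obtain y where "related f r y" using total by auto
        ultimately show ?thesis
          unfolding P_def using rel func inj assms(2) x by (metis mem_ins)
      next
        case False
        moreover obtain y where "related f x y" using total x by auto
        ultimately show ?thesis
          unfolding P_def using rel func by (metis mem_ins)
      qed
      show "x = x'" if "x \<^bold>\<in> A" "x' \<^bold>\<in> A" "P x y" "P x' y" for x x' y
        using that inj assms(2) unfolding P_def by metis
    qed
    then show ?thesis by (auto simp: size_at_most_def)
  qed
qed

lemma ins_remove: "a \<^bold>\<in> X \<Longrightarrow> ins a (remove a X) = X"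
  by (intro extensionality) auto

text \<open>The induction runs on a bound \<open>n\<close> for the size, uniformly in
  \<open>X\<close>: removing one element lowers the bound. Injections into \<open>n\<close> suffice
  for this.\<close>

lemma is_finite_induct [consumes 1, case_names definable empty ins]:
  assumes "is_finite X" "D (\<lambda>e. Q (e 0))" "Q empty"
    and step: "\<And>a X. \<not> a \<^bold>\<in> X \<Longrightarrow> Q X \<Longrightarrow> Q (ins a X)"
  shows "Q X"
proof -
  from \<open>is_finite X\<close> obtain n where n: "is_nat n" and X: "size_at_most X n"
    by (auto simp: is_finite_def size_at_most_def is_bijection_def)
  from n have "\<forall>X. size_at_most X n \<longrightarrow> Q X"
  proof (induction rule: is_nat_induct)
    case definable
    show ?case by (intro D_intros D_subst1[of Q, OF assms(2)])
  next
    case empty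
    then show ?case using \<open>Q empty\<close> size_at_most_empty by blast
  next
    case (succ n)
    show ?case
    proof (intro allI impI)
      fix X assume X: "size_at_most X (ins n n)"
      show "Q X"
      proof (cases "X = empty")
        case False
        then obtain a where a: "a \<^bold>\<in> X" by (auto simp: ext_iff)
        then have "size_at_most (remove a X) n"
          using size_at_most_ins_succ[of a "remove a X" n] X by (simp add: ins_remove)
        then show ?thesis
          using succ.IH step[of a "remove a X"] a by (simp add: ins_remove)
      qed (simp add: \<open>Q empty\<close>)
    qed
  qed
  with X show ?thesis by blast
qed

lemma is_finite_empty: "is_finite empty"
proof -
  have "is_bijection empty empty empty"
    by (simp add: is_bijection_def is_injection_def is_function_def is_relation_def related_def)
  then show ?thesis using is_nat_empty by (auto simp: is_finite_def)
qed

lemma is_finite_ins: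
  assumes "is_finite X"
  shows "is_finite (ins a X)"
proof (cases "a \<^bold>\<in> X")
  case True
  then have "ins a X = X" by (intro extensionality) auto
  with assms show ?thesis by simp
next
  case False
  obtain n f where n: "is_nat n" and f: "is_bijection f X n"
    using assms by (auto simp: is_finite_def)
  then have "is_injection f X n" by (simp add: is_bijection_def)
  then show ?thesis
  proof (rule is_injectionE)
    assume rel: "\<And>x y. related f x y \<Longrightarrow> x \<^bold>\<in> X \<and> y \<^bold>\<in> n"
      and total: "\<And>x. x \<^bold>\<in> X \<Longrightarrow> \<exists>y. related f x y"
      and func: "\<And>x y z. related f x y \<Longrightarrow> related f x z \<Longrightarrow> y = z"
      and inj: "\<And>x y z. related f x z \<Longrightarrow> related f y z \<Longrightarrow> x = y"
    \<comment> \<open>The bijection is extended by sending \<open>a\<close> to \<open>n\<close>, a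
      value not yet taken because \<open>n\<close> is not a member of itself.\<close>
    define P where "P x y \<longleftrightarrow> related f x y \<or> x = a \<and> y = n" for x y
    have P: "D (\<lambda>e. P (e 0) (e 1))"
      unfolding P_def by (intro D_intros)
    have "is_injection (graph (ins a X) (ins n n) P) (ins a X) (ins n n)"
    proof (rule is_injection_graph[OF P])
      show "\<exists>!y. y \<^bold>\<in> ins n n \<and> P x y" if x: "x \<^bold>\<in> ins a X" for x
      proof (cases "x = a")
        case True
        then show ?thesis unfolding P_def using rel False by auto
      next
        case False
        then obtain y where "related f x y" using total x by auto
        then show ?thesis unfolding P_def using rel func False by (metis mem_ins)
      qed
      show "x = x'" if "P x y" "P x' y" for x x' y
        using that rel inj False mem_irrefl[of n] unfolding P_def by metis
    qed
    moreover have "\<exists>x. x \<^bold>\<in> ins a X \<and> P x y" if "y \<^bold>\<in> ins n n" for y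
    proof (cases "y = n")
      case False
      then obtain x where "related f x y"
        using f \<open>y \<^bold>\<in> ins n n\<close> by (auto simp: is_bijection_def)
      then show ?thesis using rel by (auto simp: P_def)
    qed (auto simp: P_def)
    ultimately have "is_bijection (graph (ins a X) (ins n n) P) (ins a X) (ins n n)"
      by (auto simp: is_bijection_def related_graph[OF P])
    then show ?thesis
      using is_nat_succ[OF n] by (auto simp: is_finite_def)
  qed
qed

lemma is_finite_subset:
  assumes "is_finite X" "is_subset Y X"
  shows "is_finite Y"
proof -
  from assms(1) have "\<forall>Y. is_subset Y X \<longrightarrow> is_finite Y"
  proof (induction rule: is_finite_induct)
    case definable
    show ?case by (intro D_intros)
  next
    case empty
    have "Y = empty" if "is_subset Y empty" for Y
      using that by (simp add: is_subset_def ext_iff)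
    then show ?case using is_finite_empty by blast
  next
    case (ins a X)
    show ?case
    proof (intro allI impI)
      fix Y assume "is_subset Y (ins a X)"
      then have "is_subset (remove a Y) X" by (auto simp: is_subset_def)
      then have fin: "is_finite (remove a Y)" using ins by blast
      show "is_finite Y"
      proof (cases "a \<^bold>\<in> Y")
        case True
        then show ?thesis using is_finite_ins[OF fin, of a] by (simp add: ins_remove)
      next
        case False
        then have "remove a Y = Y" by (intro extensionality) auto
        with fin show ?thesis by simp
      qed
    qed
  qed
  with assms(2) show ?thesis by blast
qed

lemma is_finite_un:
  assumes "is_finite X" "is_finite Y"
  shows "is_finite (un X Y)"
  using assms(2)
proof (induction rule: is_finite_induct)
  case definable
  show ?case by (intro D_intros T_un)
next
  case empty
  have "un X empty = X" by (simp add: ext_iff)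
  with assms(1) show ?case by simp
next
  case (ins a Y)
  have "un X (ins a Y) = ins a (un X Y)" by (intro extensionality) auto
  then show ?case using is_finite_ins[OF ins(2)] by simp
qed

lemma is_finite_img:
  assumes "is_finite X" and h: "T (\<lambda>e. h (e 0))"
  shows "is_finite (img h X)"
  using assms(1)
proof (induction rule: is_finite_induct)
  case definable
  show ?case by (intro D_intros T_img h)
next
  case empty
  have "img h empty = empty" by (simp add: ext_iff mem_img[OF h])
  then show ?case using is_finite_empty by simp
next
  case (ins a X)
  have "img h (ins a X) = ins (h a) (img h X)" by (intro extensionality) (auto simp: mem_img[OF h])
  then show ?case using is_finite_ins[OF ins(2)] by simp
qed

text \<open>The subsets of \<open>ins a X\<close> are those of \<open>X\<close> and these with
  \<open>a\<close> added. The purpose is finiteness of the set of linear orders on a finite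
  set.\<close>

lemma is_finite_power:
  assumes "is_finite X"
  shows "is_finite (power X)"
  using assms
proof (induction rule: is_finite_induct)
  case definable
  show ?case by (intro D_intros T_power)
next
  case empty
  have "power empty = ins empty empty" by (intro extensionality) (auto simp: is_subset_def intro!: extensionality)
  then show ?case using is_finite_ins[OF is_finite_empty] by simp
next
  case (ins a X)
  have h: "T (\<lambda>e. ins a (e 0))" by (intro T_ins T_var T_const)
  have "power (ins a X) = un (power X) (img (ins a) (power X))"
    unfolding ext_iff
  proof
    fix Y
    show "Y \<^bold>\<in> power (ins a X) \<longleftrightarrow> Y \<^bold>\<in> un (power X) (img (ins a) (power X))"
      unfolding mem_un mem_power mem_img[OF h]
    proof
      assume Y: "is_subset Y (ins a X)"
      show "is_subset Y X \<or> (\<exists>Z. is_subset Z X \<and> Y = ins a Z)"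
      proof (cases "a \<^bold>\<in> Y")
        case True
        then have "is_subset (remove a Y) X \<and> Y = ins a (remove a Y)"
          using Y by (auto simp: is_subset_def ins_remove)
        then show ?thesis by blast
      next
        case False
        with Y have "is_subset Y X" by (auto simp: is_subset_def)
        then show ?thesis ..
      qed
    qed (auto simp: is_subset_def)
  qed
  then show ?case using is_finite_un is_finite_img[OF _ h] ins(2) by simp
qed

lemma lin_orderable_finite:
  assumes "is_finite X"
  shows "lin_orderable X"
  using assms
proof (induction rule: is_finite_induct)
  case definable
  show ?case by (intro D_intros)
next
  case empty
  show ?case by (rule lin_orderableI[where P = "\<lambda>_ _. True"]) (simp_all add: D_const)
next
  case (ins a X)
  then obtain r where r: "is_linear_order r X" by (auto simp: lin_orderable_def)
  \<comment> \<open>The new element \<open>a\<close> is placed on top.\<close>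
  have D: "D (\<lambda>e. related r (e 0) (e 1) \<or> e 1 = a)"
    by (intro D_intros)
  show ?case
    by (rule lin_orderableI[OF D]) (metis is_linear_orderD[OF r] ins(1) mem_ins)+
qed

text \<open>The order lives on a larger set \<open>U\<close> because minima of all members of a
  family will be taken in one common order.\<close>

lemma finite_linear_order_min:
  assumes "is_finite X" "is_linear_order r U" "is_subset X U" "X \<noteq> empty"
  shows "\<exists>m. m \<^bold>\<in> X \<and> (\<forall>x. x \<^bold>\<in> X \<longrightarrow> related r m x)"
proof -
  from assms(1) have "is_subset X U \<longrightarrow> X \<noteq> empty \<longrightarrow> (\<exists>m. m \<^bold>\<in> X \<and> (\<forall>x. x \<^bold>\<in> X \<longrightarrow> related r m x))"
  proof (induction rule: is_finite_induct)
    case definable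
    show ?case by (intro D_intros)
  next
    case empty
    show ?case by simp
  next
    case (ins a X)
    show ?case
    proof (intro impI)
      assume sub: "is_subset (ins a X) U"
      show "\<exists>m. m \<^bold>\<in> ins a X \<and> (\<forall>x. x \<^bold>\<in> ins a X \<longrightarrow> related r m x)"
      proof (cases "X = empty")
        case True
        have "a \<^bold>\<in> U" using sub by (simp add: is_subset_def)
        then show ?thesis using True is_linear_order_refl[OF assms(2)] by auto
      next
        case False
        have "a \<^bold>\<in> U" and X: "is_subset X U" using sub by (auto simp: is_subset_def)
        obtain m where m: "m \<^bold>\<in> X" "\<forall>x. x \<^bold>\<in> X \<longrightarrow> related r m x"
          using ins(2) X False by blast
        then have "m \<^bold>\<in> U" using X by (simp add: is_subset_def)
        show ?thesis
        proof (cases "related r m a")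
          case True
          with m show ?thesis by auto
        next
          case False
          then have "related r a m"
            using is_linear_order_total[OF assms(2) \<open>a \<^bold>\<in> U\<close> \<open>m \<^bold>\<in> U\<close>] by blast
          then have "\<forall>x. x \<^bold>\<in> ins a X \<longrightarrow> related r a x"
            using m(2) is_linear_order_refl[OF assms(2) \<open>a \<^bold>\<in> U\<close>]
              is_linear_order_trans[OF assms(2)] by (metis mem_ins)
          then show ?thesis by auto
        qed
      qed
    qed
  qed
  with assms show ?thesis by blast
qed

text \<open>This bound serves twice: the linear orders on \<open>X\<close> form a set by separation,
  and that set is finite when \<open>X\<close> is.\<close>

lemma linear_orders_subset:
  assumes "is_linear_order r X"
  shows "r \<^bold>\<in> power (power (power X))"
proof -
  have "p \<^bold>\<in> power (power X)" if "p \<^bold>\<in> r" for p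
    using that assms opair_mem_power
    unfolding is_linear_order_def is_relation_def is_opair_iff by blast
  then show ?thesis unfolding mem_power[of r] is_subset_def by blast
qed

lemma setlike_linear_orders: "setlike (\<lambda>r. is_linear_order r X)"
proof -
  have "setlike (\<lambda>r. r \<^bold>\<in> power (power (power X)) \<and> is_linear_order r X)"
    by (intro separation_D D_intros)
  moreover have "r \<^bold>\<in> power (power (power X)) \<and> is_linear_order r X \<longleftrightarrow> is_linear_order r X" for r
    using linear_orders_subset by blast
  ultimately show ?thesis by (simp only:)
qed

lemma mem_linear_orders [simp]: "r \<^bold>\<in> linear_orders X \<longleftrightarrow> is_linear_order r X"
  unfolding linear_orders_def by (rule mem_Coll[OF setlike_linear_orders])

lemma T_linear_orders: "T a \<Longrightarrow> T (\<lambda>e. linear_orders (a e))"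
  by (rule T_subst1[where f = linear_orders])
    (unfold linear_orders_def, intro T_Coll D_intros setlike_linear_orders)

lemma is_finite_linear_orders: "is_finite X \<Longrightarrow> is_finite (linear_orders X)"
  using is_finite_subset[OF is_finite_power[OF is_finite_power[OF is_finite_power]]]
    linear_orders_subset unfolding is_subset_def by (metis mem_linear_orders)

end

section \<open>The equivalences\<close>

context ZF_model
begin

text \<open>A finite set has some linear order, and reflexivity recovers the set from it.
  Injectivity is what transports the order of a family to the family of its
  \<open>linear_orders\<close>.\<close>

lemma linear_orders_inject:
  assumes "is_finite X" "linear_orders X = linear_orders Y"
  shows "X = Y"
proof -
  obtain r where X: "is_linear_order r X"
    using lin_orderable_finite[OF assms(1)] by (auto simp: lin_orderable_def)
  then have Y: "is_linear_order r Y"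
    using assms(2) mem_linear_orders by metis
  show ?thesis
    using is_linear_orderD(1,5)[OF X] is_linear_orderD(1,5)[OF Y] by (metis extensionality)
qed

text \<open>Choosing a linear order on each member \<open>X\<close> of \<open>F\<close> is choosing from the family of the finite
  sets \<open>linear_orders X\<close>; the union is then ordered lexicographically.\<close>

lemma unions_lin_orderable_if_choice:
  assumes choice: choice_for_lin_orderable_families
  shows unions_lin_orderable
  unfolding unions_lin_orderable_def
proof (intro allI impI, elim conjE)
  fix F U
  assume disj: "pairwise_disjoint F" and lo: "lin_orderable F" and fin: "family_of_finite F"
    and U: "is_union U F"
  obtain s where s: "is_linear_order s F"
    using lo by (auto simp: lin_orderable_def)
  have finX: "is_finite X" if "X \<^bold>\<in> F" for X
    using that fin by (simp add: family_of_finite_def)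
  define L where "L = img linear_orders F"
  have T_lo: "T (\<lambda>e. linear_orders (e 0))"
    by (intro T_linear_orders T_var)
  have mem_L: "A \<^bold>\<in> L \<longleftrightarrow> (\<exists>X. X \<^bold>\<in> F \<and> A = linear_orders X)" for A
    unfolding L_def by (rule mem_img[OF T_lo])
  have "lin_orderable L"
    unfolding L_def using lin_orderable_img[OF lo T_lo] linear_orders_inject finX by blast
  moreover have "family_of_finite L"
    using finX is_finite_linear_orders by (auto simp: family_of_finite_def mem_L)
  moreover have "\<not> is_empty A" if "A \<^bold>\<in> L" for A
    using that lin_orderable_finite finX
    by (fastforce simp: mem_L lin_orderable_def is_empty_def)
  ultimately obtain f where f: "is_choice_function f L"
    using choice by (auto simp: choice_for_lin_orderable_families_def)
  have "\<exists>r. is_linear_order r X \<and> (\<forall>r'. related f (linear_orders X) r' \<longleftrightarrow> r' = r)"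
    if "X \<^bold>\<in> F" for X
  proof -
    have L: "linear_orders X \<^bold>\<in> L" using that mem_L by blast
    then have "\<exists>!r. related f (linear_orders X) r"
      using f unfolding is_choice_function_def is_function_def by blast
    then obtain r where r: "\<And>r'. related f (linear_orders X) r' \<longleftrightarrow> r' = r"
      by metis
    then have "r \<^bold>\<in> linear_orders X"
      using f L unfolding is_choice_function_def by blast
    with r show ?thesis by auto
  qed
  then obtain ord where ord: "\<And>X. X \<^bold>\<in> F \<Longrightarrow> is_linear_order (ord X) X"
    and f_ord: "\<And>X r. X \<^bold>\<in> F \<Longrightarrow> related f (linear_orders X) r \<longleftrightarrow> r = ord X"
    by metis
  have "\<forall>x. x \<^bold>\<in> U \<longrightarrow> (\<exists>X. X \<^bold>\<in> F \<and> x \<^bold>\<in> X)"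
    using U by (simp add: is_union_def)
  then obtain c where c: "\<And>x. x \<^bold>\<in> U \<Longrightarrow> c x \<^bold>\<in> F" "\<And>x. x \<^bold>\<in> U \<Longrightarrow> x \<^bold>\<in> c x"
    by metis
  have c_unique: "X = c x" if "x \<^bold>\<in> U" "X \<^bold>\<in> F" "x \<^bold>\<in> X" for x X
    using disj c[of x] that unfolding pairwise_disjoint_def by blast
  \<comment> \<open>\<open>ord\<close> and \<open>c\<close> are HOL functions without a definability
    certificate and serve only for reasoning. \<open>P\<close> itself mentions just the elements
    \<open>F\<close>, \<open>s\<close> and \<open>f\<close> of the model.\<close>
  define P where "P x y \<longleftrightarrow> (\<exists>X Y. X \<^bold>\<in> F \<and> Y \<^bold>\<in> F \<and> x \<^bold>\<in> X \<and> y \<^bold>\<in> Y \<and>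
    (X \<noteq> Y \<and> related s X Y \<or>
     X = Y \<and> (\<exists>r. related f (linear_orders X) r \<and> related r x y)))" for x y
  have D: "D (\<lambda>e. P (e 0) (e 1))"
    unfolding P_def by (intro D_intros T_linear_orders)
  have P: "P x y \<longleftrightarrow>
      c x \<noteq> c y \<and> related s (c x) (c y) \<or> c x = c y \<and> related (ord (c x)) x y"
    if "x \<^bold>\<in> U" "y \<^bold>\<in> U" for x y
    unfolding P_def using c_unique[OF that(1)] c_unique[OF that(2)] c[OF that(1)] c[OF that(2)]
      f_ord by metis
  show "lin_orderable U"
  proof (rule lin_orderableI[OF D])
    show "P x x" if "x \<^bold>\<in> U" for x
      using P[OF that that] is_linear_order_refl[OF ord] c[OF that] by blast
    show "P x y \<or> P y x" if "x \<^bold>\<in> U" "y \<^bold>\<in> U" for x y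
    proof (cases "c x = c y")
      case True
      then show ?thesis
        using P[OF that] P[OF that(2,1)] c(2)[OF that(1)] c(2)[OF that(2)]
          is_linear_order_total[OF ord[OF c(1)[OF that(1)]], of x y] by simp
    next
      case False
      then show ?thesis
        using P[OF that] P[OF that(2,1)]
          is_linear_order_total[OF s c(1)[OF that(1)] c(1)[OF that(2)]] by auto
    qed
    show "x = y" if xy: "x \<^bold>\<in> U" "y \<^bold>\<in> U" and "P x y" "P y x" for x y
    proof -
      have "c x = c y"
        using P[OF xy] P[OF xy(2,1)] \<open>P x y\<close> \<open>P y x\<close> is_linear_order_antisym[OF s] by metis
      then have "related (ord (c x)) x y" "related (ord (c x)) y x"
        using P[OF xy] P[OF xy(2,1)] \<open>P x y\<close> \<open>P y x\<close> by simp_all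
      then show ?thesis
        by (rule is_linear_order_antisym[OF ord[OF c(1)[OF xy(1)]]])
    qed
    show "P x z" if xyz: "x \<^bold>\<in> U" "y \<^bold>\<in> U" "z \<^bold>\<in> U" and "P x y" "P y z" for x y z
    proof (cases "c x = c y \<and> c y = c z")
      case True
      then have "related (ord (c x)) x y" "related (ord (c x)) y z"
        using P[OF xyz(1,2)] P[OF xyz(2,3)] \<open>P x y\<close> \<open>P y z\<close> by simp_all
      then have "related (ord (c x)) x z"
        by (rule is_linear_order_trans[OF ord[OF c(1)[OF xyz(1)]]])
      then show ?thesis
        using P[OF xyz(1,3)] True by simp
    next
      case False
      have le: "related s (c x) (c y)" "related s (c y) (c z)"
        using P[OF xyz(1,2)] P[OF xyz(2,3)] \<open>P x y\<close> \<open>P y z\<close>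
          is_linear_order_refl[OF s c(1)] xyz by metis+
      then have "related s (c x) (c z)"
        by (rule is_linear_order_trans[OF s])
      \<comment> \<open>If \<open>c x = c z\<close>, antisymmetry of \<open>s\<close> would make
        \<open>c y\<close> equal to both, contrary to the case.\<close>
      moreover have "c x \<noteq> c z"
        using False le is_linear_order_antisym[OF s] by metis
      ultimately show ?thesis
        using P[OF xyz(1,3)] by blast
    qed
  qed
qed

text \<open>The sets \<open>{X} \<times> X\<close> are disjoint; from a linear order on their union, choose the least element
  of each.\<close>

lemma choice_if_unions_lin_orderable:
  assumes unions: unions_lin_orderable
  shows choice_for_lin_orderable_families
  unfolding choice_for_lin_orderable_families_def
proof (intro allI impI, elim conjE)
  fix F
  assume lo: "lin_orderable F" and fin: "family_of_finite F"
    and ne: "\<forall>X. X \<^bold>\<in> F \<longrightarrow> \<not> is_empty X"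
  define h where "h X = img (opair X) X" for X
  have T_opair': "T (\<lambda>e. opair X (e 0))" for X
    by (intro T_opair T_const T_var)
  have mem_h: "p \<^bold>\<in> h X \<longleftrightarrow> (\<exists>x. x \<^bold>\<in> X \<and> p = opair X x)" for p X
    unfolding h_def by (rule mem_img[OF T_opair'])
  have T_h: "T (\<lambda>e. h (e 0))"
    unfolding h_def img_def by (intro T_Coll D_intros T_opair replacement_T)
  have mem_F': "A \<^bold>\<in> img h F \<longleftrightarrow> (\<exists>X. X \<^bold>\<in> F \<and> A = h X)" for A
    by (rule mem_img[OF T_h])
  \<comment> \<open>A member of the nonempty \<open>X\<close> yields a pair whose first coordinate
    reveals \<open>X\<close>.\<close>
  have "X = Y" if XY: "X \<^bold>\<in> F" "h X = h Y" for X Y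
  proof -
    obtain x where "x \<^bold>\<in> X" using ne XY(1) by (auto simp: is_empty_def)
    then have "opair X x \<^bold>\<in> h Y" using mem_h XY(2) by metis
    then show ?thesis using mem_h by auto
  qed
  then have "lin_orderable (img h F)"
    using lin_orderable_img[OF lo T_h] by blast
  moreover have "pairwise_disjoint (img h F)"
    by (auto simp: pairwise_disjoint_def mem_F' mem_h)
  moreover have "family_of_finite (img h F)"
    using fin is_finite_img[OF _ T_opair'] by (auto simp: family_of_finite_def mem_F' h_def)
  moreover obtain U where U: "is_union U (img h F)"
    using union by blast
  ultimately obtain r where r: "is_linear_order r U"
    using unions unfolding unions_lin_orderable_def lin_orderable_def by blast
  \<comment> \<open>\<open>W\<close> is a common codomain for the choice function, whose graph must
    be a set.\<close>
  obtain W where W: "is_union W F" using union by blast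
  define Q where
    "Q X x \<longleftrightarrow> x \<^bold>\<in> X \<and> (\<forall>y. y \<^bold>\<in> X \<longrightarrow> related r (opair X x) (opair X y))" for X x
  have Q: "D (\<lambda>e. Q (e 0) (e 1))"
    unfolding Q_def by (intro D_intros T_opair)
  have "\<exists>!x. x \<^bold>\<in> W \<and> Q X x" if X: "X \<^bold>\<in> F" for X
  proof -
    have "is_finite (h X)"
      using fin X is_finite_img[OF _ T_opair'] by (simp add: family_of_finite_def h_def)
    moreover have "is_subset (h X) U"
      using U X by (auto simp: is_subset_def is_union_def mem_F')
    moreover obtain x where "x \<^bold>\<in> X" using ne X by (auto simp: is_empty_def)
    then have "h X \<noteq> empty" using mem_h mem_empty by metis
    ultimately obtain m where "m \<^bold>\<in> h X" "\<forall>p. p \<^bold>\<in> h X \<longrightarrow> related r m p"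
      using finite_linear_order_min[OF _ r] by blast
    then obtain x where "Q X x"
      unfolding Q_def mem_h by blast
    moreover have "y = z" if "Q X y" "Q X z" for y z
    proof -
      have "opair X y = opair X z"
        using that is_linear_order_antisym[OF r] unfolding Q_def by blast
      then show ?thesis by simp
    qed
    moreover have "y \<^bold>\<in> W" if "Q X y" for y
      using that W X by (auto simp: Q_def is_union_def)
    ultimately show ?thesis by blast
  qed
  then have "is_function (graph F W Q) F W"
    using is_relation_graph[OF Q] by (simp add: is_function_def related_graph[OF Q])
  then have "is_choice_function (graph F W Q) F"
    by (auto simp: is_choice_function_def related_graph[OF Q] Q_def)
  then show "\<exists>f. is_choice_function f F" ..
qed

section \<open>Antichains and generic filters\<close>

lemma is_preorderD:
  assumes "is_preorder P R"
  shows is_preorder_refl: "\<And>p. p \<^bold>\<in> P \<Longrightarrow> related R p p"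
    and is_preorder_trans: "\<And>p q r. related R p q \<Longrightarrow> related R q r \<Longrightarrow> related R p r"
    and is_preorder_mem: "\<And>p q. related R p q \<Longrightarrow> p \<^bold>\<in> P \<and> q \<^bold>\<in> P"
  using assms is_relationD[of R P P] unfolding is_preorder_def by blast+

text \<open>If \<open>p\<close> has incompatible extensions \<open>r\<close> and \<open>s\<close>, then \<open>s\<close> can be added to any antichain below
  \<open>r\<close>, so the bound on the size of antichains drops on passing from \<open>p\<close> to \<open>r\<close>.\<close>

lemma atom_exists:
  assumes "is_nat n" and pre: "is_preorder P R"
    and "p \<^bold>\<in> P" "\<And>A. is_antichain P R A \<Longrightarrow> size_at_most A n"
  shows "\<exists>q. q \<^bold>\<in> P \<and> (\<forall>r s. related R r q \<and> related R s q \<longrightarrow> compatible P R r s)"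
proof -
  note refl = is_preorder_refl[OF pre] and trans = is_preorder_trans[OF pre]
    and mem = is_preorder_mem[OF pre]
  \<comment> \<open>The bound is localised to antichains below \<open>p\<close>, since it drops only
    there, and \<open>p\<close> is quantified because the step replaces it by an extension.\<close>
  have "\<forall>p. p \<^bold>\<in> P \<longrightarrow>
      (\<forall>A. is_antichain P R A \<and> (\<forall>a. a \<^bold>\<in> A \<longrightarrow> related R a p) \<longrightarrow> size_at_most A n) \<longrightarrow>
      (\<exists>q. q \<^bold>\<in> P \<and> (\<forall>r s. related R r q \<and> related R s q \<longrightarrow> compatible P R r s))"
    using assms(1)
  proof (induction rule: is_nat_induct)
    case definable
    show ?case by (intro D_intros)
  next
    case empty
    show ?case
    proof (intro allI impI)
      fix p
      assume p: "p \<^bold>\<in> P" and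
        "\<forall>A. is_antichain P R A \<and> (\<forall>a. a \<^bold>\<in> A \<longrightarrow> related R a p) \<longrightarrow> size_at_most A empty"
      \<comment> \<open>The base case is contradictory: the singleton of \<open>p\<close> is an
        antichain that cannot inject into the empty set.\<close>
      moreover have "is_antichain P R (ins p empty)" "\<forall>a. a \<^bold>\<in> ins p empty \<longrightarrow> related R a p"
        using p refl by (simp_all add: is_antichain_def is_subset_def)
      ultimately have "ins p empty = empty"
        using size_at_most_empty by blast
      then show "\<exists>q. q \<^bold>\<in> P \<and> (\<forall>r s. related R r q \<and> related R s q \<longrightarrow> compatible P R r s)"
        by (metis mem_empty mem_ins)
    qed
  next
    case (succ n)
    show ?case
    proof (intro allI impI)
      fix p
      assume p: "p \<^bold>\<in> P" and bound:
        "\<forall>A. is_antichain P R A \<and> (\<forall>a. a \<^bold>\<in> A \<longrightarrow> related R a p) \<longrightarrow> size_at_most A (ins n n)"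
      show "\<exists>q. q \<^bold>\<in> P \<and> (\<forall>r s. related R r q \<and> related R s q \<longrightarrow> compatible P R r s)"
      proof (cases "\<forall>r s. related R r p \<and> related R s p \<longrightarrow> compatible P R r s")
        case False
        then obtain r s where r: "related R r p" and s: "related R s p"
          and incomp: "\<not> compatible P R r s"
          by blast
        have "size_at_most A n"
          if A: "is_antichain P R A" and below: "\<forall>a. a \<^bold>\<in> A \<longrightarrow> related R a r" for A
        proof -
          have as: "\<not> compatible P R a s" "\<not> compatible P R s a" if "a \<^bold>\<in> A" for a
            using incomp below that trans unfolding compatible_def by metis+
          then have "is_antichain P R (ins s A)"
            using A mem[OF s] by (auto simp: is_antichain_def is_subset_def)
          moreover have "\<forall>a. a \<^bold>\<in> ins s A \<longrightarrow> related R a p"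
            using s r below trans by (metis mem_ins)
          ultimately have "size_at_most (ins s A) (ins n n)"
            using bound by blast
          \<comment> \<open>\<open>s\<close> is compatible with itself but with no member of
            \<open>A\<close>.\<close>
          moreover have "\<not> s \<^bold>\<in> A"
            using as(1) mem[OF s] refl unfolding compatible_def by blast
          ultimately show ?thesis by (rule size_at_most_ins_succ)
        qed
        then show ?thesis using succ.IH mem[OF r] by blast
      qed (use p in blast)
    qed
  qed
  with assms(3,4) show ?thesis by blast
qed

text \<open>The filter depends on \<open>q\<close> alone and not on \<open>\<D>\<close>: each dense
  set has a member below \<open>q\<close>, and everything below \<open>q\<close> lies in
  \<open>G\<close>. This is why arbitrary families can be treated.\<close>

lemma generics_if_unions_lin_orderable:
  assumes unions: unions_lin_orderable
  shows generics_for_L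
  unfolding generics_for_L_def has_lin_orderable_generics_def
proof (intro allI impI, elim conjE)
  fix P R \<D>
  assume ne: "\<not> is_empty P" and L: "in_L P R"
    and dense: "\<forall>D. D \<^bold>\<in> \<D> \<longrightarrow> is_dense P R D"
  obtain n where n: "is_nat n" and Ln: "in_L_n n P R"
    using L by (auto simp: in_L_def)
  then have pre: "is_preorder P R" by (simp add: in_L_n_def)
  note refl = is_preorder_refl[OF pre] and trans = is_preorder_trans[OF pre]
    and mem = is_preorder_mem[OF pre]
  have "lin_orderable P"
    using Ln unions unfolding in_L_n_def unions_lin_orderable_def by blast
  obtain p where "p \<^bold>\<in> P" using ne by (auto simp: is_empty_def)
  then obtain q where q: "q \<^bold>\<in> P"
    and atom: "\<And>r s. related R r q \<Longrightarrow> related R s q \<Longrightarrow> compatible P R r s"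
    using atom_exists[OF n pre] Ln unfolding in_L_n_def by blast
  have "setlike (\<lambda>x. x \<^bold>\<in> P \<and> compatible P R x q)"
    by (intro separation_D D_intros)
  then obtain G where G: "\<And>x. x \<^bold>\<in> G \<longleftrightarrow> x \<^bold>\<in> P \<and> compatible P R x q"
    by (auto simp: setlike_def)
  have GP: "is_subset G P" by (simp add: is_subset_def G)
  have below_q: "x \<^bold>\<in> G" if "related R x q" for x
    using that mem[OF that] refl unfolding G compatible_def by blast
  have "is_filter P R G"
    unfolding is_filter_def
  proof (intro conjI allI impI, rule GP, elim conjE)
    fix x y assume "x \<^bold>\<in> G" "y \<^bold>\<in> P" "related R x y"
    then show "y \<^bold>\<in> G"
      using trans unfolding G compatible_def by blast
  next
    fix x y assume "x \<^bold>\<in> G \<and> y \<^bold>\<in> G"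
    then obtain x' y' where x': "related R x' x" "related R x' q"
      and y': "related R y' y" "related R y' q"
      unfolding G compatible_def by blast
    \<comment> \<open>\<open>x'\<close> and \<open>y'\<close> both lie below \<open>q\<close>, so
      they have a common extension.\<close>
    then obtain z where "related R z x'" "related R z y'"
      using atom[of x' y'] unfolding compatible_def by blast
    with x' y' have "related R z x" "related R z y" "related R z q"
      using trans by blast+
    then show "\<exists>r. r \<^bold>\<in> G \<and> related R r x \<and> related R r y"
      using below_q by blast
  qed
  moreover have "\<exists>d. d \<^bold>\<in> G \<and> d \<^bold>\<in> D" if "D \<^bold>\<in> \<D>" for D
    using that dense q below_q unfolding is_dense_def by blast
  ultimately show "\<exists>G. is_generic_filter P R \<D> G \<and> lin_orderable G"
    using lin_orderable_subset[OF \<open>lin_orderable P\<close> GP] unfolding is_generic_filter_def by blast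
qed

lemma generics_for_some_L_n_if_generics_for_L:
  assumes generics_for_L
  shows generics_for_some_L_n
  unfolding generics_for_some_L_n_def
proof (intro exI conjI)
  \<comment> \<open>The witness is the number 1.\<close>
  show nat: "is_nat (ins empty empty)"
    by (intro is_nat_succ is_nat_empty)
  show "ge_one (ins empty empty)"
    by (auto simp: ge_one_def is_empty_iff is_succ_iff is_subset_def)
  show "\<forall>P R. \<not> is_empty P \<and> in_L_n (ins empty empty) P R \<longrightarrow> has_lin_orderable_generics P R"
    using assms nat unfolding generics_for_L_def in_L_def by blast
qed

text \<open>Preorder the union totally by making any two elements equivalent: antichains have at most one
  element, and the only nonempty filter is the whole union.\<close>

lemma unions_lin_orderable_if_generics:
  assumes generics_for_some_L_n
  shows unions_lin_orderable
  unfolding unions_lin_orderable_def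
proof (intro allI impI)
  fix F U
  assume F: "pairwise_disjoint F \<and> lin_orderable F \<and> family_of_finite F \<and> is_union U F"
  obtain n where "ge_one n" and
    gen: "\<And>P R. \<not> is_empty P \<Longrightarrow> in_L_n n P R \<Longrightarrow> has_lin_orderable_generics P R"
    using assms unfolding generics_for_some_L_n_def by blast
  \<comment> \<open>From \<open>1 \<le> n\<close>, the element \<open>empty\<close> of
    \<open>n\<close> is available as the image of the only point of a nonempty antichain.\<close>
  then have n: "empty \<^bold>\<in> n"
    by (auto simp: ge_one_def is_empty_iff is_succ_iff is_subset_def)
  show "lin_orderable U"
  \<comment> \<open>The assumption speaks of nonempty preorders only.\<close>
  proof (cases "is_empty U")
    case True
    then show ?thesis
      using lin_orderable_finite is_finite_empty by (simp add: is_empty_iff)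
  next
    case False
    define R where "R = graph U U (\<lambda>_ _. True)"
    have R: "related R x y \<longleftrightarrow> x \<^bold>\<in> U \<and> y \<^bold>\<in> U" for x y
      unfolding R_def by (simp add: related_graph D_const)
    have "is_preorder U R"
      using is_relation_graph[of "\<lambda>_ _. True" U U]
      by (auto simp: is_preorder_def R D_const R_def[symmetric])
    moreover have "size_at_most A n" if A: "is_antichain U R A" for A
    proof -
      have "x = y" if "x \<^bold>\<in> A" "y \<^bold>\<in> A" for x y
        using that A unfolding is_antichain_def is_subset_def compatible_def R by blast
      moreover have "D (\<lambda>e. e 1 = empty)"
        by (intro D_intros)
      ultimately have "is_injection (graph A n (\<lambda>_ y. y = empty)) A n"
        using n by (intro is_injection_graph) auto
      then show ?thesis by (auto simp: size_at_most_def)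
    qed
    ultimately have "in_L_n n U R"
      using F unfolding in_L_n_def by blast
    then have "has_lin_orderable_generics U R"
      using gen False by blast
    \<comment> \<open>Filters may be empty, so genericity for the one-member family
      \<open>ins U empty\<close> is used to force a point into \<open>G\<close>.\<close>
    moreover have "is_dense U R U"
      by (auto simp: is_dense_def is_subset_def R)
    ultimately obtain G where G: "is_generic_filter U R (ins U empty) G" "lin_orderable G"
      unfolding has_lin_orderable_generics_def by (metis mem_ins mem_empty)
    then have sub: "\<forall>x. x \<^bold>\<in> G \<longrightarrow> x \<^bold>\<in> U"
      and up: "\<forall>x y. x \<^bold>\<in> G \<and> y \<^bold>\<in> U \<and> related R x y \<longrightarrow> y \<^bold>\<in> G"
      unfolding is_generic_filter_def is_filter_def is_subset_def by blast+
    obtain g where "g \<^bold>\<in> G"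
      using G(1) by (auto simp: is_generic_filter_def)
    then have "x \<^bold>\<in> G \<longleftrightarrow> x \<^bold>\<in> U" for x
      using sub up R by blast
    then have "G = U" by (intro extensionality) simp
    with G show ?thesis by simp
  qed
qed

end

theorem theorem2p7:
  fixes mem :: "'v \<Rightarrow> 'v \<Rightarrow> bool"
  assumes "ZF_model mem"
  shows "(set_structure.choice_for_lin_orderable_families mem
            \<longleftrightarrow> set_structure.unions_lin_orderable mem)
       \<and> (set_structure.unions_lin_orderable mem
            \<longleftrightarrow> set_structure.generics_for_L mem)
       \<and> (set_structure.generics_for_L mem
            \<longleftrightarrow> set_structure.generics_for_some_L_n mem)"
proof -
  interpret ZF_model mem by (fact assms)
  show ?thesis
    using unions_lin_orderable_if_choice choice_if_unions_lin_orderable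
      generics_if_unions_lin_orderable generics_for_some_L_n_if_generics_for_L
      unions_lin_orderable_if_generics by blast
qed

end
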